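(* If there is a multiple $\mathfrak{d}$-pathway, then there is a strong $\mathsf{P}$-point.
   Context: All ultrafilters are non-principal. $\mathcal{P}(\omega)$ has the topology of the Cantor space $2^\omega$. An ultrafilter $\mathcal{U}$ on $\omega$ is a strong $\mathsf{P}$-point if for every sequence $\langle\mathcal{C}_n\rangle_{n\in\omega}$ of compact subsets of $\mathcal{P}(\omega)$ with each $\mathcal{C}_n\subseteq\mathcal{U}$, there is a partition $\{P_n\mid n\in\omega\}$ of $\omega$ into (nonempty) intervals such that $\{A\subseteq\omega\mid \forall n\in\omega\ \exists X_n\in\mathcal{C}_n\ (A\cap P_n=X_n\cap P_n)\}\subseteq\mathcal{U}$. For $f,g\in\omega^\omega$, $f\le^* g$ means $f(n)\le g(n)$ for all but finitely many $n$. For a regular cardinal $\kappa>\omega_1$, $\mathsf{H}(\kappa)$ is the collection of all sets whose transitive closure has size less than $\kappa$; a well order $\trianglelefteq$ of $\mathsf{H}(\kappa)$ is fixed, and $\mathsf{Sub}(\kappa)$ is the set of all countable $M\subseteq\mathsf{H}(\kappa)$ such that $(M,\in,\trianglelefteq)$ is an elementary submodel of $(\mathsf{H}(\kappa),\in,\trianglelefteq)$. The height of $M$ is $\delta_M=M\cap\omega_1$, a countable ordinal. A finite sequence $\langle M_0,\dots,M_n\rangle$ of such models is $\delta$-increasing if $\delta_{M_i}\le\delta_{M_{i+1}}$ for each $i<n$. A relation $R\subseteq X^{n}\times\omega^\omega$ is $\le^*$-adequate if for all $x_1,\dots,x_n\in X$ there is $f\in\omega^\omega$ such that for every increasing $g\in\omega^\omega$,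 if $g\not\le^* f$ then $R(x_1,\dots,x_n,g)$ holds. Let $\kappa>\mathfrak{c}$ be a regular cardinal, $\mathcal{B}=\{f_\alpha\mid\alpha<\omega_1\}\subseteq\omega^\omega$ an indexed family of increasing functions, and $\mathcal{S}\subseteq\mathsf{Sub}(\kappa)$ a stationary subset of $[\mathsf{H}(\kappa)]^\omega$ such that $\mathcal{B}\in M$ for every $M\in\mathcal{S}$. The pair $(\mathcal{B},\mathcal{S})$ is a multiple $\mathfrak{d}$-pathway if for every $\delta$-increasing sequence $\langle M_0,\dots,M_n\rangle$ of models from $\mathcal{S}$, every projective $\le^*$-adequate relation $R\subseteq(\omega^\omega)^{n+2}$ with $R\in M_n$, and all $x_i\in M_i\cap\omega^\omega$ ($i\le n$), $R(x_0,\dots,x_n,f_{\delta_{M_n}})$ holds. *)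

theory Defs
  imports "HOL-Analysis.Analysis"
begin

unbundle cardinal_syntax

section \<open>Hereditarily bounded sets\<close>

text \<open>
  A value of type \<open>'k hset\<close> is a well-founded set all of whose hereditary members have at most
  \<open>|'k|\<close> elements: a well-founded tree whose nodes have children indexed by (part of) \<open>'k\<close>, modulo
  the extensional equality of the sets that the trees denote. The lemmas below establish
  extensionality, well-foundedness, and that every family of at most \<open>|'k|\<close> sets is a set. Hence,
  when \<open>'k\<close> is infinite, \<open>'k hset\<close> comprises all well-founded sets whose transitive closure has
  size at most \<open>|'k|\<close>.
\<close>

datatype 'k htree = Node "'k \<Rightarrow> 'k htree option"

primrec children :: "'k htree \<Rightarrow> 'k htree set" where
  "children (Node F) = {t. Some t \<in> range F}"

inductive htree_eq :: "'k htree \<Rightarrow> 'k htree \<Rightarrow> bool" where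
  "\<lbrakk>\<forall>x\<in>children s. \<exists>y\<in>children t. htree_eq x y; \<forall>y\<in>children t. \<exists>x\<in>children s. htree_eq x y\<rbrakk>
   \<Longrightarrow> htree_eq s t"

lemma htree_children_induct:
  assumes "\<And>t. (\<And>x. x \<in> children t \<Longrightarrow> P x) \<Longrightarrow> P t"
  shows "P t"
proof (induction t)
  case (Node F)
  show ?case
  proof (rule assms)
    fix x assume "x \<in> children (Node F)"
    then obtain k where "F k = Some x" by (auto dest: sym)
    then show "P x" using Node[of "F k" x] by (metis option.set_intros rangeI)
  qed
qed

lemma htree_eqD:
  assumes "htree_eq s t"
  shows "\<forall>x\<in>children s. \<exists>y\<in>children t. htree_eq x y"
    and "\<forall>y\<in>children t. \<exists>x\<in>children s. htree_eq x y"
  using htree_eq.simps[THEN iffD1, OF assms] by blast+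

lemma htree_eq_refl: "htree_eq t t"
  by (induction t rule: htree_children_induct) (rule htree_eq.intros; blast)

lemma htree_eq_sym: "htree_eq s t \<Longrightarrow> htree_eq t s"
  by (induction rule: htree_eq.induct) (rule htree_eq.intros; blast)

lemma htree_eq_trans: "htree_eq s t \<Longrightarrow> htree_eq t u \<Longrightarrow> htree_eq s u"
proof (induction arbitrary: u rule: htree_eq.induct)
  case (1 s t)
  note u = htree_eqD[OF 1(3)]
  show ?case
  proof (rule htree_eq.intros)
    show "\<forall>x\<in>children s. \<exists>y\<in>children u. htree_eq x y" using 1(1) u(1) by meson
    show "\<forall>y\<in>children u. \<exists>x\<in>children s. htree_eq x y" using 1(2) u(2) by meson
  qed
qed

quotient_type 'k hset = "'k htree" / htree_eq
  by (intro equivpI reflpI sympI transpI) (fact htree_eq_refl htree_eq_sym htree_eq_trans)+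

definition elts :: "'k hset \<Rightarrow> 'k hset set" where
  "elts x = abs_hset ` children (rep_hset x)"

text \<open>Meaningful only if \<open>|A| \<le>o |'k|\<close>; cf. \<open>elts_HSet\<close>.\<close>

definition HSet :: "'k hset set \<Rightarrow> 'k hset" where
  "HSet A = (THE x. elts x = A)"

lemma abs_hset_eq_iff: "abs_hset s = abs_hset t \<longleftrightarrow> htree_eq s t"
  by (simp add: hset.abs_eq_iff)

lemma rep_abs_hset: "htree_eq (rep_hset (abs_hset t)) t"
  by (rule Quotient3_rep_abs[OF Quotient3_hset htree_eq_refl])

lemma abs_rep_hset: "abs_hset (rep_hset x) = x"
  by (rule Quotient3_abs_rep[OF Quotient3_hset])

lemma elts_abs_hset: "elts (abs_hset t) = abs_hset ` children t"
proof -
  note 1 = htree_eqD(1)[OF rep_abs_hset[of t]] and 2 = htree_eqD(2)[OF rep_abs_hset[of t]]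
  show ?thesis unfolding elts_def
  proof (intro subset_antisym image_subsetI)
    fix x assume "x \<in> children (rep_hset (abs_hset t))"
    with 1 obtain y where "y \<in> children t" "abs_hset x = abs_hset y"
      by (auto simp: abs_hset_eq_iff)
    then show "abs_hset x \<in> abs_hset ` children t" by simp
  next
    fix y assume "y \<in> children t"
    with 2 obtain x where "x \<in> children (rep_hset (abs_hset t))" "abs_hset y = abs_hset x"
      by (metis abs_hset_eq_iff)
    then show "abs_hset y \<in> abs_hset ` children (rep_hset (abs_hset t))" by simp
  qed
qed

lemma hset_ext:
  assumes "elts x = elts y"
  shows "x = y"
proof -
  have eq: "abs_hset ` children (rep_hset x) = abs_hset ` children (rep_hset y)"
    using assms by (simp add: elts_def)
  have "htree_eq (rep_hset x) (rep_hset y)"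
  proof (rule htree_eq.intros; intro ballI)
    fix u assume "u \<in> children (rep_hset x)"
    then have "abs_hset u \<in> abs_hset ` children (rep_hset y)" by (simp flip: eq)
    then show "\<exists>v\<in>children (rep_hset y). htree_eq u v" by (auto simp: abs_hset_eq_iff)
  next
    fix v assume "v \<in> children (rep_hset y)"
    then have "abs_hset v \<in> abs_hset ` children (rep_hset x)" by (simp add: eq)
    then obtain u where "u \<in> children (rep_hset x)" "htree_eq v u"
      by (auto simp: abs_hset_eq_iff)
    then show "\<exists>u\<in>children (rep_hset x). htree_eq u v"
      using htree_eq_sym[of v u] by blast
  qed
  then have "abs_hset (rep_hset x) = abs_hset (rep_hset y)" by (simp add: abs_hset_eq_iff)
  then show ?thesis by (simp add: abs_rep_hset)
qed

lemma hset_mem_induct: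
  assumes "\<And>x. (\<And>y. y \<in> elts x \<Longrightarrow> P y) \<Longrightarrow> P x"
  shows "P x"
proof -
  have "P (abs_hset t)" for t
    by (induction t rule: htree_children_induct) (rule assms, auto simp: elts_abs_hset)
  from this[of "rep_hset x"] show ?thesis by (simp add: abs_rep_hset)
qed

lemma wf_hset_mem: "wf {(x, y). x \<in> elts y}"
proof (rule wfUNIVI)
  fix P :: "'a hset \<Rightarrow> bool" and x
  assume "\<forall>x. (\<forall>y. (y, x) \<in> {(x, y). x \<in> elts y} \<longrightarrow> P y) \<longrightarrow> P x"
  then show "P x" by (induction x rule: hset_mem_induct) simp
qed

lemma elts_HSet:
  fixes A :: "'k hset set"
  assumes "|A| \<le>o |UNIV :: 'k set|"
  shows "elts (HSet A) = A"
proof -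
  obtain h :: "'k hset \<Rightarrow> 'k" where h: "inj_on h A"
    using assms card_of_ordLeq[of A "UNIV :: 'k set"] by auto
  define F where
    "F k = (if k \<in> h ` A then Some (rep_hset (the_inv_into A h k)) else None)" for k
  have "children (Node F) = rep_hset ` A"
  proof (intro set_eqI iffI)
    fix t assume "t \<in> children (Node F)"
    then obtain k where "F k = Some t" by (auto dest: sym)
    then show "t \<in> rep_hset ` A"
      by (auto simp: F_def the_inv_into_f_f[OF h] split: if_splits)
  next
    fix t assume "t \<in> rep_hset ` A"
    then obtain a where a: "a \<in> A" "t = rep_hset a" by auto
    then have "F (h a) = Some t" by (simp add: F_def the_inv_into_f_f[OF h])
    then show "t \<in> children (Node F)" by (auto intro!: image_eqI[of _ _ "h a"])
  qed
  then have "elts (abs_hset (Node F)) = A"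
    by (simp add: elts_abs_hset image_image abs_rep_hset)
  then have "\<exists>!x. elts x = A" by (auto intro: hset_ext)
  then show ?thesis unfolding HSet_def by (rule theI')
qed

definition trcl_hset :: "'k hset \<Rightarrow> 'k hset set" where
  "trcl_hset x = {y. (y, x) \<in> {(u, v). u \<in> elts v}\<^sup>+}"

definition H :: "'k rel \<Rightarrow> 'k hset set" where
  "H \<kappa> = {x. |trcl_hset x| <o \<kappa>}"

definition regular_cardinal :: "'k rel \<Rightarrow> bool" where
  "regular_cardinal \<kappa> \<longleftrightarrow> Card_order \<kappa> \<and> infinite (Field \<kappa>) \<and> regularCard \<kappa>"


section \<open>Coding of the relevant objects as sets\<close>

definition hpair :: "'k hset \<Rightarrow> 'k hset \<Rightarrow> 'k hset" where
  "hpair x y = HSet {HSet {x}, HSet {x, y}}"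

primrec nat_code :: "nat \<Rightarrow> 'k hset" where
  "nat_code 0 = HSet {}"
| "nat_code (Suc n) = HSet (insert (nat_code n) (elts (nat_code n)))"

definition real_code :: "(nat \<Rightarrow> nat) \<Rightarrow> 'k hset" where
  "real_code g = HSet (range (\<lambda>n. hpair (nat_code n) (nat_code (g n))))"

text \<open>Elements of \<open>(\<omega>\<^sup>\<omega>)\<^sup>k\<close> are functions with domain \<open>k = {0, \<dots>, k - 1}\<close>.\<close>

definition tuple_code :: "nat \<Rightarrow> (nat \<Rightarrow> nat \<Rightarrow> nat) \<Rightarrow> 'k hset" where
  "tuple_code k x = HSet ((\<lambda>i. hpair (nat_code i) (real_code (x i))) ` {..<k})"

definition rel_code :: "nat \<Rightarrow> (nat \<Rightarrow> nat \<Rightarrow> nat) set \<Rightarrow> 'k hset" where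
  "rel_code k R = HSet (tuple_code k ` R)"

text \<open>By well-foundedness, the (von Neumann) ordinals are the hereditarily transitive sets.\<close>

definition is_ordinal :: "'k hset \<Rightarrow> bool" where
  "is_ordinal x \<longleftrightarrow>
     (\<forall>y\<in>elts x. elts y \<subseteq> elts x) \<and> (\<forall>y\<in>elts x. \<forall>z\<in>elts y. elts z \<subseteq> elts y)"

definition omega1 :: "'k hset set" where
  "omega1 = {\<alpha>. is_ordinal \<alpha> \<and> countable (elts \<alpha>)}"

text \<open>An \<open>\<omega>\<^sub>1\<close>-indexed family of reals; the values of \<open>f\<close> outside \<open>omega1\<close> are irrelevant.\<close>

definition family_code :: "('k hset \<Rightarrow> nat \<Rightarrow> nat) \<Rightarrow> 'k hset" where
  "family_code f = HSet ((\<lambda>\<alpha>. hpair \<alpha> (real_code (f \<alpha>))) ` omega1)"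


section \<open>Elementary submodels and stationary sets\<close>

datatype fm = Mem nat nat | Equal nat nat | Prec nat nat | Neg fm | Conj fm fm | Exists nat fm

primrec sat :: "'a set \<Rightarrow> ('a \<Rightarrow> 'a \<Rightarrow> bool) \<Rightarrow> ('a \<Rightarrow> 'a \<Rightarrow> bool) \<Rightarrow> fm \<Rightarrow> (nat \<Rightarrow> 'a) \<Rightarrow> bool" where
  "sat D E L (Mem i j) s \<longleftrightarrow> E (s i) (s j)"
| "sat D E L (Equal i j) s \<longleftrightarrow> s i = s j"
| "sat D E L (Prec i j) s \<longleftrightarrow> L (s i) (s j)"
| "sat D E L (Neg \<phi>) s \<longleftrightarrow> \<not> sat D E L \<phi> s"
| "sat D E L (Conj \<phi> \<psi>) s \<longleftrightarrow> sat D E L \<phi> s \<and> sat D E L \<psi> s"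
| "sat D E L (Exists i \<phi>) s \<longleftrightarrow> (\<exists>a\<in>D. sat D E L \<phi> (s(i := a)))"

definition elementary_submodel ::
  "'a set \<Rightarrow> 'a set \<Rightarrow> ('a \<Rightarrow> 'a \<Rightarrow> bool) \<Rightarrow> ('a \<Rightarrow> 'a \<Rightarrow> bool) \<Rightarrow> bool" where
  "elementary_submodel M D E L \<longleftrightarrow>
     M \<noteq> {} \<and> M \<subseteq> D \<and>
     (\<forall>\<phi> s. range s \<subseteq> M \<longrightarrow> (sat M E L \<phi> s \<longleftrightarrow> sat D E L \<phi> s))"

text \<open>The parameter \<open>W\<close> is the fixed well order of \<open>H \<kappa>\<close>.\<close>

definition Sub :: "'k rel \<Rightarrow> 'k hset rel \<Rightarrow> 'k hset set set" where
  "Sub \<kappa> W =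
     {M. countable M \<and> elementary_submodel M (H \<kappa>) (\<lambda>x y. x \<in> elts y) (\<lambda>x y. (x, y) \<in> W)}"

text \<open>The height \<open>M \<inter> \<omega>\<^sub>1\<close>, as an ordinal.\<close>

definition height :: "'k hset set \<Rightarrow> 'k hset" where
  "height M = HSet (M \<inter> omega1)"

definition countable_subsets :: "'a set \<Rightarrow> 'a set set" where
  "countable_subsets A = {X. X \<subseteq> A \<and> countable X \<and> infinite X}"

definition club :: "'a set \<Rightarrow> 'a set set \<Rightarrow> bool" where
  "club A C \<longleftrightarrow>
     C \<subseteq> countable_subsets A \<and>
     (\<forall>X\<in>countable_subsets A. \<exists>Y\<in>C. X \<subseteq> Y) \<and>
     (\<forall>X :: nat \<Rightarrow> 'a set. range X \<subseteq> C \<and> incseq X \<longrightarrow> (\<Union>n. X n) \<in> C)"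

definition stationary :: "'a set \<Rightarrow> 'a set set \<Rightarrow> bool" where
  "stationary A S \<longleftrightarrow> S \<subseteq> countable_subsets A \<and> (\<forall>C. club A C \<longrightarrow> S \<inter> C \<noteq> {})"


section \<open>Projective and adequate relations\<close>

definition baire_power :: "nat \<Rightarrow> (nat \<Rightarrow> nat \<Rightarrow> nat) topology" where
  "baire_power k = product_topology (\<lambda>_. euclidean) {..<k}"

text \<open>
  \<open>Sigma1 n k\<close> consists of the (boldface) \<open>\<Sigma>\<^sup>1\<^sub>n\<close> subsets of \<open>(\<omega>\<^sup>\<omega>)\<^sup>k\<close>
  for \<open>n \<ge> 1\<close>; the hierarchy starts with the Borel sets at \<open>n = 0\<close>.
\<close>

primrec Sigma1 :: "nat \<Rightarrow> nat \<Rightarrow> (nat \<Rightarrow> nat \<Rightarrow> nat) set set" where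
  "Sigma1 0 k = sigma_sets (topspace (baire_power k)) {U. openin (baire_power k) U}"
| "Sigma1 (Suc n) k =
     {(\<lambda>x. restrict x {..<k}) ` (topspace (baire_power (Suc k)) - A) | A. A \<in> Sigma1 n (Suc k)}"

definition projective :: "nat \<Rightarrow> (nat \<Rightarrow> nat \<Rightarrow> nat) set \<Rightarrow> bool" where
  "projective k R \<longleftrightarrow> (\<exists>n. R \<in> Sigma1 n k)"

definition le_star :: "(nat \<Rightarrow> nat) \<Rightarrow> (nat \<Rightarrow> nat) \<Rightarrow> bool" (infix "\<le>\<^sup>*" 50) where
  "f \<le>\<^sup>* g \<longleftrightarrow> (\<forall>\<^sub>F n in cofinite. f n \<le> g n)"

text \<open>Relations \<open>R \<subseteq> X\<^sup>m \<times> \<omega>\<^sup>\<omega>\<close>, the last coordinate being at index \<open>m\<close>.\<close>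

definition le_star_adequate ::
  "(nat \<Rightarrow> nat) set \<Rightarrow> nat \<Rightarrow> (nat \<Rightarrow> nat \<Rightarrow> nat) set \<Rightarrow> bool" where
  "le_star_adequate X m R \<longleftrightarrow>
     (\<forall>x \<in> {..<m} \<rightarrow>\<^sub>E X. \<exists>f. \<forall>g. strict_mono g \<and> \<not> g \<le>\<^sup>* f \<longrightarrow> x(m := g) \<in> R)"


section \<open>Multiple pathways and strong P-points\<close>

definition multiple_d_pathway ::
  "'k rel \<Rightarrow> 'k hset rel \<Rightarrow> ('k hset \<Rightarrow> nat \<Rightarrow> nat) \<Rightarrow> 'k hset set set \<Rightarrow> bool" where
  "multiple_d_pathway \<kappa> W f S \<longleftrightarrow>
     regular_cardinal \<kappa> \<and> |UNIV :: nat set set| <o \<kappa> \<and> well_order_on (H \<kappa>) W \<and>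
     (\<forall>\<alpha>\<in>omega1. strict_mono (f \<alpha>)) \<and>
     S \<subseteq> Sub \<kappa> W \<and> stationary (H \<kappa>) S \<and> (\<forall>M\<in>S. family_code f \<in> M) \<and>
     (\<forall>n M R x.
        (\<forall>i\<le>n. M i \<in> S) \<and>
        (\<forall>i<n. elts (height (M i)) \<subseteq> elts (height (M (Suc i)))) \<and>
        projective (n + 2) R \<and> le_star_adequate UNIV (n + 1) R \<and> rel_code (n + 2) R \<in> M n \<and>
        x \<in> {..<n + 1} \<rightarrow>\<^sub>E UNIV \<and> (\<forall>i\<le>n. real_code (x i) \<in> M i)
        \<longrightarrow> x(n + 1 := f (height (M n))) \<in> R)"

definition ultrafilter :: "nat set set \<Rightarrow> bool" where
  "ultrafilter U \<longleftrightarrow>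
     UNIV \<in> U \<and> {} \<notin> U \<and>
     (\<forall>A\<in>U. \<forall>B\<in>U. A \<inter> B \<in> U) \<and> (\<forall>A\<in>U. \<forall>B. A \<subseteq> B \<longrightarrow> B \<in> U) \<and>
     (\<forall>A. A \<in> U \<or> - A \<in> U) \<and>
     (\<forall>n. {n} \<notin> U)"

text \<open>Compactness in the Cantor space, a set being identified with its characteristic function.\<close>

definition cantor_compact :: "nat set set \<Rightarrow> bool" where
  "cantor_compact C \<longleftrightarrow> compact ((\<lambda>A n. n \<in> A) ` C)"

text \<open>
  In a partition into infinitely many nonempty intervals every interval is bounded.
\<close>

definition interval_partition :: "(nat \<Rightarrow> nat set) \<Rightarrow> bool" where
  "interval_partition P \<longleftrightarrow>
     (\<forall>n. \<exists>a b. a < b \<and> P n = {a..<b}) \<and> disjoint_family P \<and> (\<Union>n. P n) = UNIV"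

definition strong_P_point :: "nat set set \<Rightarrow> bool" where
  "strong_P_point U \<longleftrightarrow>
     ultrafilter U \<and>
     (\<forall>C :: nat \<Rightarrow> nat set set. (\<forall>n. cantor_compact (C n) \<and> C n \<subseteq> U) \<longrightarrow>
        (\<exists>P. interval_partition P \<and> {A. \<forall>n. \<exists>X\<in>C n. A \<inter> P n = X \<inter> P n} \<subseteq> U))"

end

theory Submission
  imports Defs
begin

text \<open>
  Every real \<open>y\<close> lies in some model \<open>M\<close> of the stationary set; its level is the height \<open>\<delta>\<close> of \<open>M\<close>, and
  \<open>f\<^sub>\<delta>\<close> yields an interval partition. A real that codes an increasing sequence of compact sets \<open>C\<^sub>n\<close>
  (through the finite traces of their members) is a task. A task contributes to the ultrafilter the
  compact family \<open>K\<close> of all sets that agree on the \<open>n\<close>-th interval with some member of \<open>C\<^sub>n\<close>, provided that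
  the \<open>C\<^sub>n\<close> have the strong finite intersection property together with the families \<open>K\<close> of lower levels
  and the compact sets of the earlier tasks of the same level. By compactness this proviso is a
  Borel condition on the tasks: it bounds where the intersections must hit, and if the intervals are
  not dominated by that bound, then replacing the \<open>C\<^sub>n\<close> by \<open>K\<close> preserves the property. This implication is
  the projective adequate relation to which the pathway is applied, with \<open>f\<close> at the lower levels as
  parameter. Any ultrafilter that extends the families \<open>K\<close> of all tasks that contribute is a strong
  P-point: if all \<open>C\<^sub>n\<close> are contained in it, then nothing prevents their task from contributing.
\<close>

section \<open>Ordinals and hereditarily small sets\<close>

lemma is_ordinal_elem: "is_ordinal x \<Longrightarrow> y \<in> elts x \<Longrightarrow> is_ordinal y"
  unfolding is_ordinal_def by blast

lemma is_ordinal_trans: "is_ordinal x \<Longrightarrow> z \<in> elts y \<Longrightarrow> y \<in> elts x \<Longrightarrow> z \<in> elts x"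
  unfolding is_ordinal_def by blast

text \<open>By double induction on membership: if neither set belongs to the other, the induction
  hypotheses and transitivity show that they have the same elements.\<close>

lemma is_ordinal_linear:
  "is_ordinal x \<Longrightarrow> is_ordinal y \<Longrightarrow> x \<in> elts y \<or> x = y \<or> y \<in> elts x"
proof (induction x arbitrary: y rule: hset_mem_induct)
  case (1 x)
  note IHx = 1(1) and x = 1(2)
  from 1(3) show ?case
  proof (induction y rule: hset_mem_induct)
    case (1 y)
    have "x = y" if "x \<notin> elts y" "y \<notin> elts x"
    proof (rule hset_ext, intro subset_antisym subsetI)
      fix z assume z: "z \<in> elts x"
      with IHx[OF z is_ordinal_elem[OF x z] 1(2)] is_ordinal_trans[OF x] that
      show "z \<in> elts y" by blast
    next
      fix z assume z: "z \<in> elts y"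
      with 1(1)[OF z is_ordinal_elem[OF 1(2) z]] is_ordinal_trans[OF 1(2)] that
      show "z \<in> elts x" by blast
    qed
    then show ?case by blast
  qed
qed

lemma elem_omega1: "\<alpha> \<in> omega1 \<Longrightarrow> \<beta> \<in> elts \<alpha> \<Longrightarrow> \<beta> \<in> omega1"
  unfolding omega1_def mem_Collect_eq
  using is_ordinal_elem[of \<alpha> \<beta>] by (auto simp: is_ordinal_def intro: countable_subset)

lemma trcl_hset_eq: "trcl_hset x = elts x \<union> (\<Union>y\<in>elts x. trcl_hset y)"
  unfolding trcl_hset_def by (auto elim: tranclE intro: trancl_into_trancl)

lemma trcl_ordinal:
  assumes "is_ordinal x"
  shows "trcl_hset x = elts x"
proof -
  have "y \<in> elts x" if "(y, x) \<in> {(u, v). u \<in> elts v}\<^sup>+" for y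
    using that assms
    by (induction rule: converse_trancl_induct) (auto intro: is_ordinal_trans)
  then show ?thesis unfolding trcl_hset_def by auto
qed

section \<open>Small sets and codes inside H \<kappa>\<close>

locale hereditary =
  fixes \<kappa> :: "'k rel"
  assumes reg: "regular_cardinal \<kappa>" and big: "|UNIV :: nat set set| <o \<kappa>"
begin

lemma countable_small: "countable A \<Longrightarrow> |A| <o \<kappa>"
proof -
  assume "countable A"
  then have "|A| \<le>o |UNIV :: nat set|"
    by (metis UNIV_I card_of_ordLeq countable_def subsetI)
  also have "|UNIV :: nat set| \<le>o |UNIV :: nat set set|"
    by (rule card_of_ordLeq[THEN iffD1]) (auto simp: inj_on_def intro!: exI[of _ "\<lambda>n. {n}"])
  finally show ?thesis using big ordLeq_ordLess_trans by blast
qed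

text \<open>For \<open>rel_code_in_H\<close>: the graph of each member is coded by a set of natural
  numbers, so there are at most continuum many members.\<close>

lemma real_rel_small: "|R :: (nat \<Rightarrow> nat \<Rightarrow> nat) set| <o \<kappa>"
proof -
  have "inj (\<lambda>x::nat \<Rightarrow> nat \<Rightarrow> nat. {prod_encode (i, prod_encode (j, x i j)) | i j. True})"
  proof (rule injI)
    fix x y :: "nat \<Rightarrow> nat \<Rightarrow> nat"
    assume eq: "{prod_encode (i, prod_encode (j, x i j)) | i j. True}
      = {prod_encode (i, prod_encode (j, y i j)) | i j. True}"
    show "x = y"
    proof (intro ext)
      fix i j
      have "prod_encode (i, prod_encode (j, x i j)) \<in> {prod_encode (i, prod_encode (j, y i j)) | i j. True}"
        using eq by blast
      then show "x i j = y i j" by auto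
    qed
  qed
  then have "|R| \<le>o |UNIV :: nat set set|"
    by (rule card_of_ordLeqI[OF inj_on_subset[OF _ subset_UNIV] UNIV_I])
  then show ?thesis using big ordLeq_ordLess_trans by blast
qed

text \<open>\<open>HSet\<close> is reliable on sets no larger than the type \<open>'k\<close>. This
  covers all sets smaller than \<kappa>, because the field of \<kappa> is a subset of that
  type.\<close>

lemma elts_HSet_small: "|A :: 'k hset set| <o \<kappa> \<Longrightarrow> elts (HSet A) = A"
proof (rule elts_HSet)
  assume A: "|A| <o \<kappa>"
  have "\<kappa> \<le>o |Field \<kappa>|"
    using reg unfolding regular_cardinal_def by (simp add: Card_order_iff_ordLeq_card_of[symmetric])
  also have "|Field \<kappa>| \<le>o |UNIV :: 'k set|" by (rule card_of_mono1) simp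
  finally show "|A| \<le>o |UNIV :: 'k set|"
    using A ordLess_imp_ordLeq ordLess_ordLeq_trans by blast
qed

lemma Cinf: "Cinfinite \<kappa>"
  using reg unfolding regular_cardinal_def cinfinite_def by auto

text \<open>Regularity of \<kappa> bounds the union of the transitive closures of the
  members.\<close>

lemma HSet_in_H:
  assumes "A \<subseteq> H \<kappa>" "|A| <o \<kappa>"
  shows "HSet A \<in> H \<kappa>"
proof -
  have r: "regularCard \<kappa>" using reg unfolding regular_cardinal_def by auto
  have "|\<Union>y\<in>A. trcl_hset y| <o \<kappa>"
    by (rule regularCard_UNION_bound[OF Cinf r assms(2)]) (use assms(1) in \<open>auto simp: H_def\<close>)
  with assms(2) have "|A \<union> (\<Union>y\<in>A. trcl_hset y)| <o \<kappa>"
    using Cinf by (intro card_of_Un_ordLess_infinite_Field) (auto simp: cinfinite_def)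
  then show ?thesis
    unfolding H_def mem_Collect_eq trcl_hset_eq[of "HSet A"] elts_HSet_small[OF assms(2)] .
qed

lemma hpair_in_H: "x \<in> H \<kappa> \<Longrightarrow> y \<in> H \<kappa> \<Longrightarrow> hpair x y \<in> H \<kappa>"
  unfolding hpair_def by (auto intro!: HSet_in_H countable_small)

lemma nat_code_in_H: "(nat_code n :: 'k hset) \<in> H \<kappa> \<and> elts (nat_code n :: 'k hset) \<subseteq> H \<kappa> \<and>
    countable (elts (nat_code n :: 'k hset))"
proof (induction n)
  case 0
  have "elts (HSet {} :: 'k hset) = {}" by (rule elts_HSet_small) (simp add: countable_small)
  then show ?case by (simp add: HSet_in_H countable_small)
next
  case (Suc n)
  then have "countable (insert (nat_code n) (elts (nat_code n)) :: 'k hset set)" by simp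
  note c = countable_small[OF this]
  show ?case using Suc by (auto simp: elts_HSet_small[OF c] intro!: HSet_in_H c)
qed

lemma real_code_in_H: "real_code g \<in> H \<kappa>"
  unfolding real_code_def
  by (intro HSet_in_H) (auto intro!: countable_small hpair_in_H simp: nat_code_in_H)

lemma tuple_code_in_H: "tuple_code k x \<in> H \<kappa>"
  unfolding tuple_code_def
  by (intro HSet_in_H)
    (auto intro!: countable_small hpair_in_H real_code_in_H simp: nat_code_in_H countable_finite)

lemma rel_code_in_H: "rel_code k R \<in> H \<kappa>"
  unfolding rel_code_def
  by (intro HSet_in_H)
    (auto intro!: tuple_code_in_H ordLeq_ordLess_trans[OF card_of_image real_rel_small])

lemma omega1_subset_H: "omega1 \<subseteq> H \<kappa>"
  unfolding omega1_def H_def by (auto simp: trcl_ordinal intro: countable_small)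

lemma elts_height: "countable (M :: 'k hset set) \<Longrightarrow> elts (height M) = M \<inter> omega1"
  unfolding height_def by (rule elts_HSet_small) (simp add: countable_small countable_Int1)

end

section \<open>Levels of reals\<close>

text \<open>Finitely many arguments from the union of an increasing chain already lie in one member
  of the chain. Hence \<omega> rounds of closing off suffice, and increasing unions of closed sets
  are closed.\<close>

lemma club_closed_sets:
  fixes \<Gamma> :: "'a list \<Rightarrow> 'a set"
  assumes \<Gamma>: "\<And>xs. set xs \<subseteq> D \<Longrightarrow> \<Gamma> xs \<subseteq> D \<and> countable (\<Gamma> xs)"
  shows "club D {X \<in> countable_subsets D. \<forall>xs. set xs \<subseteq> X \<longrightarrow> \<Gamma> xs \<subseteq> X}"
  unfolding club_def
proof (intro conjI ballI allI impI)
  fix X assume X: "X \<in> countable_subsets D"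
  define step where "step Y = Y \<union> (\<Union>xs\<in>lists Y. \<Gamma> xs)" for Y
  define Y where "Y = (\<Union>n. (step ^^ n) X)"
  have st: "(step ^^ n) X \<subseteq> D \<and> countable ((step ^^ n) X)" for n
  proof (induction n)
    case 0
    then show ?case using X by (auto simp: countable_subsets_def)
  next
    case (Suc n)
    then have "countable (lists ((step ^^ n) X))" by auto
    moreover have "\<Gamma> xs \<subseteq> D \<and> countable (\<Gamma> xs)" if "xs \<in> lists ((step ^^ n) X)" for xs
      using \<Gamma>[of xs] that Suc by (auto simp: in_lists_conv_set)
    ultimately show ?case using Suc unfolding step_def by (auto simp: subset_iff)
  qed
  have mono: "mono (\<lambda>n. (step ^^ n) X)"
    by (rule mono_iff_le_Suc[THEN iffD2]) (auto simp: step_def)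
  have XY: "X \<subseteq> Y" unfolding Y_def using UN_upper[of 0 UNIV "\<lambda>n. (step ^^ n) X"] by simp
  have "\<Gamma> xs \<subseteq> Y" if "set xs \<subseteq> Y" for xs
  proof -
    have "\<exists>n. set xs \<subseteq> (step ^^ n) X" using that
    proof (induction xs)
      case (Cons a xs)
      then obtain n m where "a \<in> (step ^^ n) X" "set xs \<subseteq> (step ^^ m) X" by (auto simp: Y_def)
      then have "set (a # xs) \<subseteq> (step ^^ max n m) X"
        using monoD[OF mono, of n "max n m"] monoD[OF mono, of m "max n m"] by auto
      then show ?case by blast
    qed simp
    then obtain n where "set xs \<subseteq> (step ^^ n) X" by blast
    then have "\<Gamma> xs \<subseteq> (step ^^ Suc n) X" by (auto simp: step_def in_lists_conv_set)
    then show ?thesis unfolding Y_def by blast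
  qed
  moreover have "Y \<in> countable_subsets D"
    using st XY X unfolding countable_subsets_def Y_def by (auto dest: infinite_super)
  ultimately show "\<exists>Y\<in>{X \<in> countable_subsets D. \<forall>xs. set xs \<subseteq> X \<longrightarrow> \<Gamma> xs \<subseteq> X}. X \<subseteq> Y"
    using XY by blast
next
  fix X :: "nat \<Rightarrow> 'a set"
  assume X: "range X \<subseteq> {X \<in> countable_subsets D. \<forall>xs. set xs \<subseteq> X \<longrightarrow> \<Gamma> xs \<subseteq> X} \<and> incseq X"
  then have X1: "X n \<in> countable_subsets D" "set xs \<subseteq> X n \<Longrightarrow> \<Gamma> xs \<subseteq> X n" for n xs
    by auto
  have "(\<Union>n. X n) \<in> countable_subsets D"
    using X1(1) infinite_super[of "X 0" "\<Union>n. X n"] unfolding countable_subsets_def by auto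
  moreover have "\<Gamma> xs \<subseteq> (\<Union>n. X n)" if "set xs \<subseteq> (\<Union>n. X n)" for xs
  proof -
    have "\<exists>n. set xs \<subseteq> X n" using that
    proof (induction xs)
      case (Cons a xs)
      then obtain n m where "a \<in> X n" "set xs \<subseteq> X m" by auto
      then have "set (a # xs) \<subseteq> X (max n m)"
        using incseqD[of X n "max n m"] incseqD[of X m "max n m"] X by auto
      then show ?case by blast
    qed simp
    then show ?thesis using X1(2) by blast
  qed
  ultimately show "(\<Union>n. X n) \<in> {X \<in> countable_subsets D. \<forall>xs. set xs \<subseteq> X \<longrightarrow> \<Gamma> xs \<subseteq> X}"
    by blast
qed auto

text \<open>
  Elementarity is not used: for each real, stationarity provides a model that contains the real and is
  closed under the countably many operations that are needed.
\<close>

lemma pathway_levels: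
  fixes \<kappa> :: "'k rel" and R :: "nat \<Rightarrow> (nat \<Rightarrow> nat) list \<Rightarrow> (nat \<Rightarrow> nat \<Rightarrow> nat) set"
  assumes pw: "multiple_d_pathway \<kappa> W f S"
    and proj: "\<And>n \<phi>. projective (n + 2) (R n \<phi>)"
    and adeq: "\<And>n \<phi>. le_star_adequate UNIV (n + 1) (R n \<phi>)"
  obtains lev :: "(nat \<Rightarrow> nat) \<Rightarrow> 'k hset" where
    "\<And>y. is_ordinal (lev y)"
    "\<And>n r x. \<lbrakk>\<And>i. i < n \<Longrightarrow> lev (x i) = lev (x (Suc i)) \<or> lev (x i) \<in> elts (lev (x (Suc i)));
       \<And>i. i < r \<Longrightarrow> lev (x i) \<in> elts (lev (x n))\<rbrakk>
     \<Longrightarrow> (restrict x {..<n + 1})(n + 1 := f (lev (x n))) \<in> R n (map (\<lambda>i. f (lev (x i))) [0..<r])"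
proof -
  interpret hereditary \<kappa>
    using pw by unfold_locales (auto simp: multiple_d_pathway_def)
  \<comment> \<open>A model closed under these operations contains \<open>y\<close>; its countable
    ordinals form a transitive set, so that its height is an ordinal; and it contains each relation
    whose parameters are values of \<open>f\<close> at ordinals of the model.\<close>
  define \<Gamma> where "\<Gamma> y xs = insert (real_code y) ((\<Union>\<alpha>\<in>set xs \<inter> omega1. elts \<alpha>) \<union>
      range (\<lambda>n. rel_code (n + 2) (R n (map f xs))))" for y xs
  have "club (H \<kappa>) {X \<in> countable_subsets (H \<kappa>). \<forall>xs. set xs \<subseteq> X \<longrightarrow> \<Gamma> y xs \<subseteq> X}" for y
  proof (rule club_closed_sets)
    fix xs :: "'k hset list"
    have "countable (elts \<alpha>)" if "\<alpha> \<in> omega1" for \<alpha> :: "'k hset"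
      using that by (simp add: omega1_def)
    then show "\<Gamma> y xs \<subseteq> H \<kappa> \<and> countable (\<Gamma> y xs)"
      using omega1_subset_H elem_omega1 unfolding \<Gamma>_def
      by (intro conjI insert_subsetI Un_least UN_least image_subsetI countable_insert countable_Un countable_UN)
        (auto intro: real_code_in_H rel_code_in_H countable_finite)
  qed
  moreover have "stationary (H \<kappa>) S" using pw by (simp add: multiple_d_pathway_def)
  ultimately have "\<exists>M. M \<in> S \<and> M \<in> countable_subsets (H \<kappa>) \<and> (\<forall>xs. set xs \<subseteq> M \<longrightarrow> \<Gamma> y xs \<subseteq> M)" for y
    unfolding stationary_def by blast
  then obtain M where M: "\<And>y. M y \<in> S" "\<And>y. M y \<in> countable_subsets (H \<kappa>)"
    "\<And>y xs. set xs \<subseteq> M y \<Longrightarrow> \<Gamma> y xs \<subseteq> M y" by metis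
  define lev where "lev y = height (M y)" for y
  have elts_lev: "elts (lev y) = M y \<inter> omega1" for y
    unfolding lev_def using M(2)[of y] by (intro elts_height) (simp add: countable_subsets_def)
  have "elts \<alpha> \<subseteq> M y" if "\<alpha> \<in> M y" "\<alpha> \<in> omega1" for \<alpha> y
    using M(3)[of "[\<alpha>]" y] that by (auto simp: \<Gamma>_def)
  then have ord: "is_ordinal (lev y)" for y
    unfolding is_ordinal_def[of "lev y"] elts_lev
  proof (intro conjI ballI)
    fix \<beta> assume "\<beta> \<in> M y \<inter> omega1"
    then show "elts \<beta> \<subseteq> M y \<inter> omega1" using elem_omega1[of \<beta>] \<open>\<And>\<alpha> y. \<lbrakk>\<alpha> \<in> M y; \<alpha> \<in> omega1\<rbrakk> \<Longrightarrow> elts \<alpha> \<subseteq> M y\<close> by blast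
  qed (simp add: omega1_def is_ordinal_def)
  show ?thesis
  proof (rule that[OF ord])
    fix n r and x :: "nat \<Rightarrow> nat \<Rightarrow> nat"
    assume mono: "\<And>i. i < n \<Longrightarrow> lev (x i) = lev (x (Suc i)) \<or> lev (x i) \<in> elts (lev (x (Suc i)))"
      and low: "\<And>i. i < r \<Longrightarrow> lev (x i) \<in> elts (lev (x n))"
    let ?\<phi> = "map (\<lambda>i. f (lev (x i))) [0..<r]"
    \<comment> \<open>The lower levels are elements of the height of \<open>M (x n)\<close>, hence
      of the model itself. Closure under \<open>\<Gamma>\<close> then yields the relation with the
      values of \<open>f\<close> at these levels as parameters.\<close>
    have "set (map (\<lambda>i. lev (x i)) [0..<r]) \<subseteq> M (x n)"
      using low by (auto simp: elts_lev)
    from M(3)[OF this] have "rel_code (n + 2) (R n ?\<phi>) \<in> M (x n)"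
      by (auto simp: \<Gamma>_def comp_def)
    moreover have "real_code y \<in> M y" for y
      using M(3)[of "[]" y] by (auto simp: \<Gamma>_def)
    moreover have "elts (height (M (x i))) \<subseteq> elts (height (M (x (Suc i))))" if "i < n" for i
      using mono[OF that] ord[of "x (Suc i)"] unfolding lev_def is_ordinal_def by auto
    moreover have path: "\<forall>n M R x.
        (\<forall>i\<le>n. M i \<in> S) \<and>
        (\<forall>i<n. elts (height (M i)) \<subseteq> elts (height (M (Suc i)))) \<and>
        projective (n + 2) R \<and> le_star_adequate UNIV (n + 1) R \<and> rel_code (n + 2) R \<in> M n \<and>
        x \<in> {..<n + 1} \<rightarrow>\<^sub>E UNIV \<and> (\<forall>i\<le>n. real_code (x i) \<in> M i)
        \<longrightarrow> x(n + 1 := f (height (M n))) \<in> R"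
      using pw unfolding multiple_d_pathway_def by blast
    ultimately have "(\<forall>i\<le>n. M (x i) \<in> S) \<and>
        (\<forall>i<n. elts (height (M (x i))) \<subseteq> elts (height (M (x (Suc i))))) \<and>
        projective (n + 2) (R n ?\<phi>) \<and> le_star_adequate UNIV (n + 1) (R n ?\<phi>) \<and>
        rel_code (n + 2) (R n ?\<phi>) \<in> M (x n) \<and> restrict x {..<n + 1} \<in> {..<n + 1} \<rightarrow>\<^sub>E UNIV \<and>
        (\<forall>i\<le>n. real_code (restrict x {..<n + 1} i) \<in> M (x i))"
      using M(1) proj adeq by (simp add: less_Suc_eq_le)
    from path[rule_format, OF this]
    show "(restrict x {..<n + 1})(n + 1 := f (lev (x n))) \<in> R n ?\<phi>"
      unfolding lev_def .
  qed
qed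

section \<open>Finitary coding of compact sets\<close>

text \<open>
  \<open>coded x j m\<close> is the collection of traces on \<open>m\<close> of the members of the \<open>j\<close>-th compact set coded by \<open>x\<close>.
\<close>

definition coded :: "(nat \<Rightarrow> nat) \<Rightarrow> nat \<Rightarrow> nat \<Rightarrow> nat set set" where
  "coded x j m = set_decode ` set_decode (x (prod_encode (j, m)))"

text \<open>The endpoints are chosen so that large values of \<open>g\<close> make long blocks while
  no block is empty, whatever \<open>g\<close> is. Each endpoint depends only on the values of
  \<open>g\<close> below it.\<close>

primrec bnd :: "(nat \<Rightarrow> nat) \<Rightarrow> nat \<Rightarrow> nat" where
  "bnd g 0 = 0"
| "bnd g (Suc n) = Suc (bnd g n + g (bnd g n))"

definition block :: "(nat \<Rightarrow> nat) \<Rightarrow> nat \<Rightarrow> nat set" where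
  "block g n = {bnd g n..<bnd g (Suc n)}"

text \<open>A finite approximation to membership in the j-th compact set; the sets that pass it for
  every \<open>m\<close> form \<open>branches x j\<close>.\<close>

definition near :: "(nat \<Rightarrow> nat) \<Rightarrow> nat \<Rightarrow> nat \<Rightarrow> nat set \<Rightarrow> bool" where
  "near x j m A \<longleftrightarrow> (\<exists>t\<in>coded x j m. t \<inter> {..<m} = A \<inter> {..<m})"

text \<open>Testing only the blocks that end by \<open>m\<close> makes the condition depend on
  finitely many values of \<open>x\<close> and \<open>g\<close> and on \<open>A\<close> below
  \<open>m\<close>.\<close>

definition follows :: "(nat \<Rightarrow> nat) \<Rightarrow> (nat \<Rightarrow> nat) \<Rightarrow> nat \<Rightarrow> nat set \<Rightarrow> bool" where
  "follows x g m A \<longleftrightarrow>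
     (\<forall>n. bnd g (Suc n) \<le> m \<longrightarrow> (\<exists>t\<in>coded x n (bnd g (Suc n)). t \<inter> block g n = A \<inter> block g n))"

definition meet :: "nat \<Rightarrow> nat \<Rightarrow> nat \<Rightarrow> (nat \<Rightarrow> nat set) \<Rightarrow> bool" where
  "meet n k m A \<longleftrightarrow> (\<exists>l\<in>{k..<m}. \<forall>i\<le>n. l \<in> A i)"

text \<open>
  For \<open>i < length \<phi>\<close>, the task \<open>x i\<close> has a lower level, at which the family takes the value \<open>\<phi> ! i\<close>; the
  other tasks are at the top level, whose value of the family is the last coordinate \<open>x (n + 1)\<close>. A
  task may occur several times, so one set for each \<open>i\<close> suffices.
\<close>

definition compatible_at ::
  "nat \<Rightarrow> (nat \<Rightarrow> nat) list \<Rightarrow> nat \<Rightarrow> nat \<Rightarrow> nat \<Rightarrow> (nat \<Rightarrow> nat \<Rightarrow> nat) \<Rightarrow> bool" where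
  "compatible_at n \<phi> j k m x \<longleftrightarrow>
     (\<forall>A. (\<forall>i\<le>n. if i < length \<phi> then follows (x i) (\<phi> ! i) m (A i) else near (x i) j m (A i))
        \<longrightarrow> meet n k m A)"

text \<open>All large \<open>m\<close> are demanded because an arbitrary real need not code a task,
  so \<open>compatible_at\<close> need not persist from \<open>m\<close> to \<open>Suc m\<close>,
  and the block endpoints at which it is applied cannot be prescribed.\<close>

definition compatible :: "nat \<Rightarrow> (nat \<Rightarrow> nat) list \<Rightarrow> (nat \<Rightarrow> nat \<Rightarrow> nat) \<Rightarrow> bool" where
  "compatible n \<phi> x \<longleftrightarrow> (\<forall>j k. \<exists>m0. \<forall>m\<ge>m0. compatible_at n \<phi> j k m x)"

definition linked_at ::
  "nat \<Rightarrow> (nat \<Rightarrow> nat) list \<Rightarrow> nat \<Rightarrow> nat \<Rightarrow> (nat \<Rightarrow> nat \<Rightarrow> nat) \<Rightarrow> bool" where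
  "linked_at n \<phi> k m x \<longleftrightarrow>
     (\<forall>A. (\<forall>i\<le>n. follows (x i) (if i < length \<phi> then \<phi> ! i else x (Suc n)) m (A i))
        \<longrightarrow> meet n k m A)"

definition linked :: "nat \<Rightarrow> (nat \<Rightarrow> nat) list \<Rightarrow> (nat \<Rightarrow> nat \<Rightarrow> nat) \<Rightarrow> bool" where
  "linked n \<phi> x \<longleftrightarrow> (\<forall>k. \<exists>m. linked_at n \<phi> k m x)"

definition linking :: "nat \<Rightarrow> (nat \<Rightarrow> nat) list \<Rightarrow> (nat \<Rightarrow> nat \<Rightarrow> nat) set" where
  "linking n \<phi> = {x \<in> topspace (baire_power (n + 2)). compatible n \<phi> x \<longrightarrow> linked n \<phi> x}"

section \<open>Interval partitions and dependence on finitely many values\<close>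

lemma bnd_strict_mono: "strict_mono (bnd g)"
  by (simp add: strict_mono_Suc_iff)

lemma bnd_ge: "n \<le> bnd g n"
  by (rule strict_mono_imp_increasing[OF bnd_strict_mono])

lemma in_some_block: "\<exists>n. l \<in> block g n"
proof -
  define n where "n = (LEAST n. l < bnd g n)"
  have ex: "l < bnd g (Suc l)" using bnd_ge[of "Suc l" g] by simp
  then have n: "l < bnd g n" unfolding n_def by (rule LeastI)
  then obtain n' where "n = Suc n'" by (cases n) auto
  moreover have "\<not> l < bnd g n'" unfolding n_def
    using not_less_Least[of n' "\<lambda>n. l < bnd g n"] \<open>n = Suc n'\<close> n_def by auto
  ultimately show ?thesis using n by (intro exI[of _ n']) (simp add: block_def)
qed

lemma disjoint_blocks: "disjoint_family (block g)"
proof -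
  have "block g i \<inter> block g j = {}" if "i < j" for i j
    using strict_mono_leD[OF bnd_strict_mono, of "Suc i" j g] that by (auto simp: block_def)
  then show ?thesis unfolding disjoint_family_on_def by (metis inf_commute linorder_neqE_nat)
qed

lemma interval_partition_block: "interval_partition (block g)"
proof -
  have "\<exists>a b. a < b \<and> block g n = {a..<b}" for n
    unfolding block_def using strict_monoD[OF bnd_strict_mono lessI] by blast
  moreover have "(\<Union>n. block g n) = UNIV" using in_some_block by blast
  ultimately show ?thesis unfolding interval_partition_def using disjoint_blocks by blast
qed

lemma bnd_cong: "(\<And>l. l < m \<Longrightarrow> g l = g' l) \<Longrightarrow> bnd g n \<le> m \<Longrightarrow> bnd g' n = bnd g n"
  by (induction n) auto

text \<open>Up to \<open>m\<close>, the condition reads \<open>g\<close> below \<open>m\<close> and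
  \<open>x\<close> at codes of pairs bounded by \<open>m\<close>; the bound \<open>L\<close> covers
  both.\<close>

lemma follows_cong_imp:
  assumes L: "\<And>l. l < L \<Longrightarrow> x l = x' l \<and> g l = g' l" "m \<le> L"
      "\<And>n p. n \<le> m \<Longrightarrow> p \<le> m \<Longrightarrow> prod_encode (n, p) < L"
    and f: "follows x g m A"
  shows "follows x' g' m A"
  unfolding follows_def
proof (intro allI impI)
  fix n assume n: "bnd g' (Suc n) \<le> m"
  have m: "g' l = g l" if "l < m" for l using L(1)[of l] that L(2) by simp
  have eq: "bnd g (Suc n) = bnd g' (Suc n)" using bnd_cong[OF m n] by simp
  have "bnd g' n \<le> m" using n by simp
  then have eq': "bnd g n = bnd g' n" using bnd_cong[OF m] by simp
  have "n \<le> m" using bnd_ge[of "Suc n" g'] n by simp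
  then have "coded x n (bnd g (Suc n)) = coded x' n (bnd g' (Suc n))"
    using L(1)[OF L(3)[OF _ n]] by (simp only: coded_def eq)
  then show "\<exists>t\<in>coded x' n (bnd g' (Suc n)). t \<inter> block g' n = A \<inter> block g' n"
    using f n unfolding follows_def block_def eq' by (metis eq eq')
qed

lemma follows_cong:
  assumes L: "\<And>l. l < L \<Longrightarrow> x l = x' l" "\<And>l. l < L \<Longrightarrow> g l = g' l" "m \<le> L"
      "\<And>n p. n \<le> m \<Longrightarrow> p \<le> m \<Longrightarrow> prod_encode (n, p) < L"
  shows "follows x g m A = follows x' g' m A"
  using follows_cong_imp[of L x x' g g' m A] follows_cong_imp[of L x' x g' g m A] L by auto

lemma near_cong: "x (prod_encode (j, m)) = x' (prod_encode (j, m)) \<Longrightarrow> near x j m A = near x' j m A"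
  by (simp add: near_def coded_def)

section \<open>Projectivity and adequacy\<close>

text \<open>Both arguments are quantified, so the implication amounts to an equivalence, and the
  notion is closed under negation.\<close>

definition finitary :: "nat \<Rightarrow> ((nat \<Rightarrow> nat \<Rightarrow> nat) \<Rightarrow> bool) \<Rightarrow> bool" where
  "finitary k \<Phi> \<longleftrightarrow> (\<exists>L. \<forall>x y. (\<forall>i<k. \<forall>l<L. x i l = y i l) \<longrightarrow> \<Phi> x \<longrightarrow> \<Phi> y)"

lemma prod_encode_bound: "\<exists>L\<ge>m. \<forall>n\<le>m. \<forall>p\<le>m. prod_encode (n, p) < (L::nat)"
proof -
  obtain L where L: "\<forall>a\<in>prod_encode ` ({..m} \<times> {..m}). a < L"
    using finite_nat_set_iff_bounded[of "prod_encode ` ({..m} \<times> {..m})"] by auto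
  then show ?thesis by (intro exI[of _ "max m L"]) (auto simp: less_max_iff_disj)
qed

lemma finitary_compatible_at: "finitary (n + 2) (compatible_at n \<phi> j k m)"
proof -
  obtain L where L: "L \<ge> max j m"
      "\<And>a b. a \<le> max j m \<Longrightarrow> b \<le> max j m \<Longrightarrow> prod_encode (a, b) < L"
    using prod_encode_bound[of "max j m"] by auto
  have "compatible_at n \<phi> j k m y"
    if eq: "\<forall>i<n + 2. \<forall>l<L. x i l = y i l" and x: "compatible_at n \<phi> j k m x" for x y
    unfolding compatible_at_def
  proof (intro allI impI)
    fix A
    assume A: "\<forall>i\<le>n. if i < length \<phi> then follows (y i) (\<phi> ! i) m (A i) else near (y i) j m (A i)"
    have "follows (x i) (\<phi> ! i) m (A i) = follows (y i) (\<phi> ! i) m (A i)" if "i \<le> n" for i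
      by (rule follows_cong[of L]) (use eq that L in auto)
    moreover have "near (x i) j m (A i) = near (y i) j m (A i)" if "i \<le> n" for i
      by (rule near_cong) (use eq that L in auto)
    ultimately show "meet n k m A" using x A unfolding compatible_at_def by simp
  qed
  then show ?thesis unfolding finitary_def by blast
qed

lemma finitary_linked_at: "finitary (n + 2) (linked_at n \<phi> k m)"
proof -
  obtain L where L: "L \<ge> m" "\<And>a b. a \<le> m \<Longrightarrow> b \<le> m \<Longrightarrow> prod_encode (a, b) < L"
    using prod_encode_bound[of m] by auto
  have "linked_at n \<phi> k m y"
    if eq: "\<forall>i<n + 2. \<forall>l<L. x i l = y i l" and x: "linked_at n \<phi> k m x" for x y
    unfolding linked_at_def
  proof (intro allI impI)
    fix A
    assume A: "\<forall>i\<le>n. follows (y i) (if i < length \<phi> then \<phi> ! i else y (Suc n)) m (A i)"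
    have "follows (x i) (if i < length \<phi> then \<phi> ! i else x (Suc n)) m (A i) =
        follows (y i) (if i < length \<phi> then \<phi> ! i else y (Suc n)) m (A i)" if "i \<le> n" for i
      by (rule follows_cong[of L]) (use eq that L in auto)
    then show "meet n k m A" using x A unfolding linked_at_def by blast
  qed
  then show ?thesis unfolding finitary_def by blast
qed

text \<open>With each of its points the set contains a basic open cylinder, given by the first
  \<open>L\<close> values in each coordinate.\<close>

lemma finitary_open:
  assumes "finitary k \<Phi>"
  shows "openin (baire_power k) {x \<in> topspace (baire_power k). \<Phi> x}"
proof -
  obtain L where L: "\<And>x y. (\<forall>i<k. \<forall>l<L. x i l = y i l) \<Longrightarrow> \<Phi> x \<Longrightarrow> \<Phi> y"
    using assms unfolding finitary_def by blast
  define cyl where "cyl x = ({..<k} \<rightarrow>\<^sub>E UNIV :: (nat \<Rightarrow> nat \<Rightarrow> nat) set) \<inter>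
      {y. \<forall>i<k. \<forall>l<L. y i l = x i l}" for x :: "nat \<Rightarrow> nat \<Rightarrow> nat"
  have top: "topspace (baire_power k) = {..<k} \<rightarrow>\<^sub>E UNIV"
    by (simp add: baire_power_def)
  have "open {y :: nat \<Rightarrow> nat. \<forall>l<L. y l = c l}" for c
  proof -
    have "open ((\<lambda>y :: nat \<Rightarrow> nat. y l) -` {c l})" for l
      by (rule open_vimage) (auto intro: open_discrete continuous_on_product_coordinates)
    then have "open (\<Inter>l<L. (\<lambda>y :: nat \<Rightarrow> nat. y l) -` {c l})" by (intro open_INT) auto
    also have "(\<Inter>l<L. (\<lambda>y :: nat \<Rightarrow> nat. y l) -` {c l}) = {y. \<forall>l<L. y l = c l}" by auto
    finally show ?thesis .
  qed
  moreover have "cyl x = ({..<k} \<rightarrow>\<^sub>E (UNIV :: (nat \<Rightarrow> nat) set)) \<inter> (\<Pi>\<^sub>E i\<in>{..<k}. {y. \<forall>l<L. y l = x i l})" for x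
    unfolding cyl_def by (auto simp: PiE_iff)
  then have "cyl x = (\<Pi>\<^sub>E i\<in>{..<k}. {y. \<forall>l<L. y l = x i l})" for x
    by (auto simp: PiE_iff)
  ultimately have op: "openin (baire_power k) (cyl x)" for x
    unfolding baire_power_def by (simp add: openin_PiE_gen)
  have "{x \<in> topspace (baire_power k). \<Phi> x} = \<Union> (cyl ` {x \<in> topspace (baire_power k). \<Phi> x})"
  proof (intro subset_antisym subsetI)
    fix y assume "y \<in> \<Union> (cyl ` {x \<in> topspace (baire_power k). \<Phi> x})"
    then obtain x where x: "\<Phi> x" "y \<in> cyl x" by blast
    then show "y \<in> {x \<in> topspace (baire_power k). \<Phi> x}"
      using L[of x y] unfolding top cyl_def by auto
  qed (auto simp: cyl_def top)
  also have "openin (baire_power k) \<dots>" using op by (intro openin_Union) auto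
  finally show ?thesis .
qed

text \<open>The relation arises from finitary conditions by quantifiers over natural numbers and an
  implication. It is therefore Borel, which is level 0 of the projective hierarchy.\<close>

lemma projective_linking: "projective (n + 2) (linking n \<phi>)"
proof -
  define N where "N = sigma (topspace (baire_power (n + 2))) {U. openin (baire_power (n + 2)) U}"
  have sub: "{U. openin (baire_power (n + 2)) U} \<subseteq> Pow (topspace (baire_power (n + 2)))"
    by (auto dest: openin_subset)
  have space: "space N = topspace (baire_power (n + 2))"
    unfolding N_def by (rule space_measure_of[OF sub])
  have sets: "sets N = sigma_sets (topspace (baire_power (n + 2))) {U. openin (baire_power (n + 2)) U}"
    unfolding N_def by (rule sets_measure_of[OF sub])
  have fin: "Measurable.pred N \<Phi>" if "finitary (n + 2) \<Phi>" for \<Phi>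
    unfolding pred_def space sets using finitary_open[OF that] by auto
  note [measurable] = fin[OF finitary_compatible_at] fin[OF finitary_linked_at]
  have "Measurable.pred N (\<lambda>x. compatible n \<phi> x \<longrightarrow> linked n \<phi> x)"
    unfolding compatible_def linked_def by measurable
  then have "linking n \<phi> \<in> sets N" unfolding linking_def pred_def space .
  then have "linking n \<phi> \<in> Sigma1 0 (n + 2)" by (simp add: sets)
  then show ?thesis unfolding projective_def by blast
qed

text \<open>
  If \<open>h (h m) < g m\<close>, then the block of \<open>m\<close> or the next one is long: either the block of \<open>m\<close> extends
  beyond \<open>h m\<close>, or the next one starts between \<open>m\<close> and \<open>h m\<close> and extends beyond \<open>g m\<close>.
\<close>

lemma long_block:
  fixes h :: "nat \<Rightarrow> nat"
  assumes mono: "mono h" and g: "strict_mono g" "\<not> g \<le>\<^sup>* (\<lambda>m. h (h m))"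
  obtains J q where "k \<le> q" "J \<le> q" "bnd g J \<le> q" "h q \<le> bnd g (Suc J)"
proof -
  have "infinite {m. \<not> g m \<le> h (h m)}"
    using g(2) unfolding le_star_def eventually_cofinite .
  then obtain m where m: "k \<le> m" "h (h m) < g m"
    unfolding infinite_nat_iff_unbounded_le by (auto simp: not_le)
  obtain J where J: "bnd g J \<le> m" "m < bnd g (Suc J)"
    using in_some_block[of m g] by (auto simp: block_def)
  show ?thesis
  proof (cases "h m \<le> bnd g (Suc J)")
    case True
    show ?thesis by (rule that[of m J]) (use m J True bnd_ge[of J g] in auto)
  next
    case False
    define q where "q = bnd g (Suc J)"
    have "h q \<le> h (h m)" using False by (intro monoD[OF mono]) (simp add: q_def)
    also have "\<dots> \<le> g m" using m by simp
    also have "\<dots> \<le> g q" using J by (intro strict_mono_leD[OF g(1)]) (simp add: q_def)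
    also have "\<dots> \<le> bnd g (Suc (Suc J))" by (simp add: q_def)
    finally show ?thesis
      by (intro that[of q "Suc J"]) (use m J bnd_ge[of "Suc J" g] in \<open>auto simp: q_def\<close>)
  qed
qed

text \<open>The function to be escaped is \<open>h\<close> composed with itself, where
  \<open>h\<close> bounds how far up the intersections of compatible tasks must hit. If
  \<open>g\<close> escapes it, some block \<open>J\<close> contains the whole interval from
  \<open>q\<close> to \<open>h q\<close>, and inside that block selections look like members of the
  J-th compact sets.\<close>

lemma adequate_linking: "le_star_adequate UNIV (n + 1) (linking n \<phi>)"
  unfolding le_star_adequate_def
proof
  fix x :: "nat \<Rightarrow> nat \<Rightarrow> nat" assume x: "x \<in> {..<n + 1} \<rightarrow>\<^sub>E UNIV"
  then have top: "x(n + 1 := g) \<in> topspace (baire_power (n + 2))" for g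
    by (auto simp: baire_power_def PiE_iff extensional_def)
  \<comment> \<open>Compatibility does not see the last coordinate, so the bound can be extracted
    before \<open>g\<close> is given.\<close>
  have comp: "compatible n \<phi> (x(n + 1 := g)) = compatible n \<phi> x" for g
    unfolding compatible_def compatible_at_def by simp
  show "\<exists>f. \<forall>g. strict_mono g \<and> \<not> g \<le>\<^sup>* f \<longrightarrow> x(n + 1 := g) \<in> linking n \<phi>"
  proof (cases "compatible n \<phi> x")
    case False
    then show ?thesis using top comp unfolding linking_def by auto
  next
    case True
    then obtain m0 where m0: "\<And>j k m. m0 j k \<le> m \<Longrightarrow> compatible_at n \<phi> j k m x"
      unfolding compatible_def by metis
    \<comment> \<open>One monotone function that bounds \<open>m0 j k\<close> for all
      \<open>j\<close> up to \<open>k\<close>.\<close>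
    define h where "h k = (\<Sum>j\<le>k. \<Sum>l\<le>k. m0 j l)" for k
    have "mono h" unfolding h_def
      by (intro monoI order_trans[OF sum_mono sum_mono2] sum_mono2) auto
    have h: "m0 j k \<le> h k" if "j \<le> k" for j k
    proof -
      have "m0 j k \<le> (\<Sum>l\<le>k. m0 j l)" by (intro member_le_sum) auto
      also have "\<dots> \<le> h k" unfolding h_def using that by (intro member_le_sum) auto
      finally show ?thesis .
    qed
    have "x(n + 1 := g) \<in> linking n \<phi>" if g: "strict_mono g" "\<not> g \<le>\<^sup>* (\<lambda>m. h (h m))" for g
    proof -
      have "\<exists>m. linked_at n \<phi> k m (x(n + 1 := g))" for k
      proof -
        obtain J q where q: "k \<le> q" "J \<le> q" "bnd g J \<le> q" "h q \<le> bnd g (Suc J)"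
          by (rule long_block[OF \<open>mono h\<close> g, of k])
        define m where "m = bnd g (Suc J)"
        have "linked_at n \<phi> k m (x(n + 1 := g))"
          unfolding linked_at_def
        proof (intro allI impI)
          fix A assume A: "\<forall>i\<le>n. follows ((x(n + 1 := g)) i)
              (if i < length \<phi> then \<phi> ! i else (x(n + 1 := g)) (Suc n)) m (A i)"
          \<comment> \<open>Block \<open>J\<close> ends exactly at \<open>m\<close>, so it is among
            the blocks that \<open>follows\<close> tests.\<close>
          have "\<exists>t\<in>coded (x i) J m. t \<inter> block g J = A i \<inter> block g J"
            if "i \<le> n" "\<not> i < length \<phi>" for i
            using A that unfolding follows_def m_def by fastforce
          then obtain t where t: "t i \<in> coded (x i) J m \<and> t i \<inter> block g J = A i \<inter> block g J"
            if "i \<le> n" "\<not> i < length \<phi>" for i by metis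
          \<comment> \<open>Top-level sets are exchanged for coded traces that agree with them on
            block \<open>J\<close>. Compatibility then gives a common point at or above
            \<open>q\<close>, which lies in block \<open>J\<close> and hence in the original
            sets.\<close>
          define B where "B i = (if i < length \<phi> then A i else t i)" for i
          have "if i < length \<phi> then follows (x i) (\<phi> ! i) m (B i) else near (x i) J m (B i)"
            if "i \<le> n" for i
            using A t[of i] that unfolding B_def near_def by (auto split: if_splits)
          moreover have "compatible_at n \<phi> J q m x"
            by (rule m0) (use h[of J q] q m_def in simp)
          ultimately have "meet n q m B" unfolding compatible_at_def by blast
          then obtain l where l: "l \<in> {q..<m}" "\<forall>i\<le>n. l \<in> B i" unfolding meet_def by blast
          then have "l \<in> block g J" using q by (auto simp: block_def m_def)
          then have "\<forall>i\<le>n. l \<in> A i" using l t unfolding B_def by (metis IntD1 IntI)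
          then show "meet n k m A" using l q unfolding meet_def by auto
        qed
        then show ?thesis by blast
      qed
      then show ?thesis unfolding linking_def linked_def using top by auto
    qed
    then show ?thesis by blast
  qed
qed

section \<open>Compactness and ultrafilters\<close>

lemma closed_cylinder: "closed {a :: 'i \<Rightarrow> bool. \<forall>p\<in>I. a p = b p}"
proof -
  have "closed ((\<lambda>a :: 'i \<Rightarrow> bool. a p) -` {b p})" for p
    by (rule closed_vimage) (auto intro: continuous_on_product_coordinates)
  then have "closed (\<Inter>p\<in>I. (\<lambda>a :: 'i \<Rightarrow> bool. a p) -` {b p})" by (intro closed_INT) auto
  also have "(\<Inter>p\<in>I. (\<lambda>a :: 'i \<Rightarrow> bool. a p) -` {b p}) = {a. \<forall>p\<in>I. a p = b p}" by auto
  finally show ?thesis .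
qed

lemma compact_nested:
  fixes F :: "nat \<Rightarrow> 'a::topological_space set"
  assumes "compact S" "\<And>m. closed (F m)" "\<And>m. F (Suc m) \<subseteq> F m" "\<And>m. S \<inter> F m \<noteq> {}"
  obtains a where "a \<in> S" "\<And>m. a \<in> F m"
proof -
  have dec: "decseq F" by (rule decseq_SucI) (rule assms(3))
  have "S \<inter> (\<Inter>m\<in>UNIV. F m) \<noteq> {}"
  proof (rule compact_imp_fip_image[OF assms(1,2)])
    fix I :: "nat set" assume "finite I"
    then obtain m where "\<forall>i\<in>I. i \<le> m" using finite_nat_set_iff_bounded_le by blast
    then have "F m \<subseteq> (\<Inter>i\<in>I. F i)" using decseqD[OF dec] by blast
    then show "S \<inter> (\<Inter>i\<in>I. F i) \<noteq> {}" using assms(4)[of m] by blast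
  qed
  then show ?thesis using that by blast
qed

lemma compact_UNIV_Cantor: "compact (UNIV :: ('i \<Rightarrow> bool) set)"
proof -
  have "compactin (product_topology (\<lambda>_. euclidean) UNIV) (\<Pi>\<^sub>E i\<in>(UNIV :: 'i set). (UNIV :: bool set))"
    unfolding compactin_PiE by (simp add: finite_imp_compact)
  then show ?thesis by (simp add: euclidean_product_topology)
qed

text \<open>Koenig's lemma in topological form: by \<open>local\<close> each condition defines a
  closed set of families, these sets decrease and are nonempty, so compactness gives a common
  point.\<close>

lemma koenig:
  fixes \<Phi> :: "nat \<Rightarrow> (nat \<Rightarrow> nat set) \<Rightarrow> bool"
  assumes local: "\<And>m A B. \<lbrakk>\<And>i. i \<le> n \<Longrightarrow> A i \<inter> {..<m} = B i \<inter> {..<m}; \<Phi> m A\<rbrakk> \<Longrightarrow> \<Phi> m B"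
    and anti: "\<And>m A. \<Phi> (Suc m) A \<Longrightarrow> \<Phi> m A"
    and ex: "\<And>m. \<exists>A. \<Phi> m A"
  obtains A where "\<And>m. \<Phi> m A"
proof -
  \<comment> \<open>A family of sets is treated as a point of the Cantor space over pairs;
    \<open>\<Phi> m\<close> depends only on indices up to \<open>n\<close> and elements below
    \<open>m\<close>.\<close>
  define sets where "sets a i = {l. a (i, l)}" for a :: "nat \<times> nat \<Rightarrow> bool" and i
  define cyl where "cyl m b = {a. \<forall>p\<in>{..n} \<times> {..<m}. a p = b p}" for m and b :: "nat \<times> nat \<Rightarrow> bool"
  have cyl: "\<Phi> m (sets a)" if "a \<in> cyl m b" "\<Phi> m (sets b)" for a b m
    by (rule local[OF _ that(2)]) (use that(1) in \<open>auto simp: cyl_def sets_def\<close>)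
  have "closed {a. \<Phi> m (sets a)}" for m
  proof -
    have "open (\<Union>b\<in>{b. \<not> \<Phi> m (sets b)}. cyl m b)"
    proof (intro open_UN ballI)
      fix b :: "nat \<times> nat \<Rightarrow> bool"
      have "open ((\<lambda>a :: nat \<times> nat \<Rightarrow> bool. a p) -` {b p})" for p
        by (rule open_vimage) (auto intro: open_discrete continuous_on_product_coordinates)
      then have "open (\<Inter>p\<in>{..n} \<times> {..<m}. (\<lambda>a :: nat \<times> nat \<Rightarrow> bool. a p) -` {b p})"
        by (intro open_INT) auto
      also have "(\<Inter>p\<in>{..n} \<times> {..<m}. (\<lambda>a :: nat \<times> nat \<Rightarrow> bool. a p) -` {b p}) = cyl m b"
        by (auto simp: cyl_def)
      finally show "open (cyl m b)" .
    qed
    moreover have "(\<Union>b\<in>{b. \<not> \<Phi> m (sets b)}. cyl m b) = - {a. \<Phi> m (sets a)}"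
    proof (intro subset_antisym subsetI)
      fix a assume "a \<in> (\<Union>b\<in>{b. \<not> \<Phi> m (sets b)}. cyl m b)"
      then obtain b where "\<not> \<Phi> m (sets b)" "b \<in> cyl m a" by (auto simp: cyl_def)
      then show "a \<in> - {a. \<Phi> m (sets a)}" using cyl by blast
    qed (auto simp: cyl_def)
    ultimately show ?thesis by (simp add: closed_def)
  qed
  moreover have "UNIV \<inter> {a. \<Phi> m (sets a)} \<noteq> {}" for m
  proof -
    obtain A where "\<Phi> m A" using ex by blast
    moreover have "A = sets (\<lambda>(i, l). l \<in> A i)" by (auto simp: sets_def)
    ultimately have "\<Phi> m (sets (\<lambda>(i, l). l \<in> A i))" by simp
    then show ?thesis by blast
  qed
  ultimately obtain a where "\<And>m. a \<in> {a. \<Phi> m (sets a)}"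
    using compact_nested[OF compact_UNIV_Cantor, of "\<lambda>m. {a. \<Phi> m (sets a)}"] anti by blast
  then show ?thesis using that by blast
qed

text \<open>The closed cylinders around \<open>X\<close> shrink to \<open>X\<close> and all meet
  \<open>C\<close>, so compactness puts \<open>X\<close> into \<open>C\<close>.\<close>

lemma cantor_compact_limit:
  assumes "cantor_compact C" "\<And>m. \<exists>Y\<in>C. Y \<inter> {..<m} = X \<inter> {..<m}"
  shows "X \<in> C"
proof -
  let ?F = "\<lambda>m. {a. \<forall>p\<in>{..<m}. a p = (p \<in> X)}"
  have "?F (Suc m) \<subseteq> ?F m" for m by auto
  moreover have "(\<lambda>A n. n \<in> A) ` C \<inter> ?F m \<noteq> {}" for m
  proof -
    obtain Y where "Y \<in> C" "Y \<inter> {..<m} = X \<inter> {..<m}" using assms(2) by blast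
    then show ?thesis by blast
  qed
  ultimately obtain a where a: "a \<in> (\<lambda>A n. n \<in> A) ` C" "\<And>m. a \<in> ?F m"
    by (rule compact_nested[OF assms(1)[unfolded cantor_compact_def] closed_cylinder]) blast+
  obtain Y where Y: "Y \<in> C" "a = (\<lambda>n. n \<in> Y)" using a(1) by blast
  have "n \<in> Y \<longleftrightarrow> n \<in> X" for n using a(2)[of "Suc n"] Y by auto
  then have "Y = X" by blast
  with Y show ?thesis by simp
qed

section \<open>The strong finite intersection property and ultrafilters\<close>

definition sfip :: "nat set set \<Rightarrow> bool" where
  "sfip F \<longleftrightarrow> (\<forall>Q\<subseteq>F. finite Q \<longrightarrow> infinite (\<Inter>Q))"

lemma sfipD: "sfip F \<Longrightarrow> Q \<subseteq> F \<Longrightarrow> finite Q \<Longrightarrow> infinite (\<Inter>Q)"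
  by (simp add: sfip_def)

lemma sfip_mono: "sfip F \<Longrightarrow> G \<subseteq> F \<Longrightarrow> sfip G"
  unfolding sfip_def by (meson subset_trans)

text \<open>A maximal family with the property, obtained from Zorn's lemma, is an ultrafilter. It
  contains no singleton because finite intersections of its members are infinite.\<close>

lemma ultrafilter_extends:
  assumes "sfip F"
  obtains U where "ultrafilter U" "F \<subseteq> U"
proof -
  have "\<exists>M\<in>{G. F \<subseteq> G \<and> sfip G}. \<forall>X\<in>{G. F \<subseteq> G \<and> sfip G}. M \<subseteq> X \<longrightarrow> X = M"
  proof (rule subset_Zorn_nonempty)
    fix \<C> assume C: "\<C> \<noteq> {}" "subset.chain {G. F \<subseteq> G \<and> sfip G} \<C>"
    have "infinite (\<Inter>Q)" if Q: "Q \<subseteq> \<Union>\<C>" "finite Q" for Q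
    proof -
      obtain B where "B \<in> \<C>" "Q \<subseteq> B" using finite_subset_Union_chain[OF Q(2,1) C] .
      moreover have "sfip B" using C(2) \<open>B \<in> \<C>\<close> by (auto simp: subset.chain_def)
      ultimately show ?thesis using Q(2) by (auto simp: sfip_def)
    qed
    moreover have "F \<subseteq> \<Union>\<C>"
    proof -
      obtain B where "B \<in> \<C>" using C(1) by blast
      moreover from this have "F \<subseteq> B" using C(2) unfolding subset.chain_def by blast
      ultimately show ?thesis by blast
    qed
    ultimately show "\<Union>\<C> \<in> {G. F \<subseteq> G \<and> sfip G}" by (simp add: sfip_def)
  qed (use assms in auto)
  then obtain U where U': "U \<in> {G. F \<subseteq> G \<and> sfip G}" "\<forall>X\<in>{G. F \<subseteq> G \<and> sfip G}. U \<subseteq> X \<longrightarrow> X = U" ..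
  then have U: "F \<subseteq> U" "sfip U" by simp_all
  have max: "X = U" if "sfip X" "U \<subseteq> X" for X
    using U'(2) U(1) that by (metis (mono_tags) mem_Collect_eq order_trans)
  \<comment> \<open>By maximality, a set outside \<open>U\<close> has only finitely many points in
    common with some finite intersection of members.\<close>
  have ext: "\<exists>Q\<subseteq>U. finite Q \<and> finite (\<Inter>Q \<inter> A)" if "A \<notin> U" for A
  proof -
    have "\<not> sfip (insert A U)" using max[of "insert A U"] that by blast
    then obtain Q where Q: "Q \<subseteq> insert A U" "finite Q" "finite (\<Inter>Q)" by (auto simp: sfip_def)
    have "\<Inter>(Q - {A}) \<inter> A \<subseteq> \<Inter>Q" by blast
    then have "finite (\<Inter>(Q - {A}) \<inter> A)" using Q(3) finite_subset by blast
    then show ?thesis using Q by (intro exI[of _ "Q - {A}"]) auto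
  qed
  have dich: "A \<in> U \<or> - A \<in> U" for A
  proof (rule ccontr)
    assume "\<not> ?thesis"
    then obtain Q1 Q2 where Q: "Q1 \<subseteq> U" "finite Q1" "finite (\<Inter>Q1 \<inter> A)"
      "Q2 \<subseteq> U" "finite Q2" "finite (\<Inter>Q2 \<inter> - A)" using ext[of A] ext[of "- A"] by blast
    have "\<Inter>(Q1 \<union> Q2) \<subseteq> (\<Inter>Q1 \<inter> A) \<union> (\<Inter>Q2 \<inter> - A)" by blast
    then have "finite (\<Inter>(Q1 \<union> Q2))" using Q finite_subset by blast
    moreover have "Q1 \<union> Q2 \<subseteq> U" "finite (Q1 \<union> Q2)" using Q by auto
    ultimately show False using U(2) by (auto simp: sfip_def)
  qed
  have disj: False if "Q \<subseteq> U" "finite Q" "finite (\<Inter>Q)" for Q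
    using that U(2) by (auto simp: sfip_def)
  have "ultrafilter U"
    unfolding ultrafilter_def
  proof (intro conjI ballI allI impI)
    show "{} \<notin> U" using disj[of "{{}}"] by auto
    then show "UNIV \<in> U" using dich[of UNIV] by simp
    show "A \<inter> B \<in> U" if AB: "A \<in> U" "B \<in> U" for A B
    proof (rule ccontr)
      assume "A \<inter> B \<notin> U"
      then have "- (A \<inter> B) \<in> U" using dich by blast
      moreover have "\<Inter>{A, B, - (A \<inter> B)} = {}" by blast
      ultimately show False using disj[of "{A, B, - (A \<inter> B)}"] AB by simp
    qed
    show "B \<in> U" if AB: "A \<in> U" "A \<subseteq> B" for A B
    proof (rule ccontr)
      assume "B \<notin> U"
      then have "- B \<in> U" using dich by blast
      moreover have "\<Inter>{A, - B} = {}" using AB by blast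
      ultimately show False using disj[of "{A, - B}"] AB(1) by simp
    qed
    show "{n} \<notin> U" for n using disj[of "{{n}}"] by auto
  qed (rule dich)
  with U(1) show ?thesis using that by blast
qed

lemma ultrafilter_Inter:
  assumes "ultrafilter U"
  shows "finite Q \<Longrightarrow> Q \<subseteq> U \<Longrightarrow> \<Inter>Q \<in> U"
  by (induction Q rule: finite_induct) (use assms in \<open>auto simp: ultrafilter_def\<close>)

lemma ultrafilter_infinite:
  assumes U: "ultrafilter U" and A: "A \<in> U"
  shows "infinite A"
proof
  assume fin: "finite A"
  have "- {n} \<in> U" for n using U unfolding ultrafilter_def by blast
  then have "insert A ((\<lambda>n. - {n}) ` A) \<subseteq> U" using A by blast
  then have "\<Inter>(insert A ((\<lambda>n. - {n}) ` A)) \<in> U" by (intro ultrafilter_Inter[OF U]) (simp_all add: fin)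
  moreover have "\<Inter>(insert A ((\<lambda>n. - {n}) ` A)) = {}" by auto
  ultimately show False using U unfolding ultrafilter_def by auto
qed

lemma ultrafilter_sfip: "ultrafilter U \<Longrightarrow> sfip U"
  unfolding sfip_def by (intro allI impI ultrafilter_infinite ultrafilter_Inter)

section \<open>Sorting finite sets along a total preorder\<close>

lemma finite_has_greatest:
  assumes "finite Q" "Q \<noteq> {}"
    and "\<And>p q. p \<in> Q \<Longrightarrow> q \<in> Q \<Longrightarrow> le p q \<or> le q p"
    and "\<And>p q r. le p q \<Longrightarrow> le q r \<Longrightarrow> le p r"
  shows "\<exists>m\<in>Q. \<forall>q\<in>Q. le q m"
  using assms(1-3)
proof (induction Q rule: finite_ne_induct)
  case (insert a Q)
  then obtain m where m: "m \<in> Q" "\<forall>q\<in>Q. le q m" by blast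
  have "le a a" "le a m \<or> le m a" using insert.prems m(1) by blast+
  then show ?case using m assms(4) by blast
qed blast

text \<open>Remove a greatest element and enumerate the rest first. Ties are allowed, since distinct
  sets may come from tasks of the same level.\<close>

lemma finite_sorted_enumeration:
  assumes "finite Q" "Q \<noteq> {}"
    and "\<And>p q. p \<in> Q \<Longrightarrow> q \<in> Q \<Longrightarrow> le p q \<or> le q p"
    and "\<And>p q r. le p q \<Longrightarrow> le q r \<Longrightarrow> le p r"
  shows "\<exists>(n :: nat) A. A ` {..n} = Q \<and> (\<forall>i j. i \<le> j \<longrightarrow> j \<le> n \<longrightarrow> le (A i) (A j))"
  using assms(1-3)
proof (induction "card Q" arbitrary: Q rule: less_induct)
  case less
  obtain m where m: "m \<in> Q" "\<forall>q\<in>Q. le q m"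
    using finite_has_greatest[of Q le] less.prems assms(4) by blast
  show ?case
  proof (cases "Q = {m}")
    case True
    then show ?thesis using m by (intro exI[of _ 0] exI[of _ "\<lambda>_. m"]) auto
  next
    case False
    have "card (Q - {m}) < card Q" using m less.prems by (meson card_Diff1_less)
    moreover have "Q - {m} \<noteq> {}" using False m by blast
    ultimately obtain n A where A: "A ` {..n} = Q - {m}"
        "\<forall>i j. i \<le> j \<longrightarrow> j \<le> (n::nat) \<longrightarrow> le (A i) (A j)"
      using less.hyps[of "Q - {m}"] less.prems(1,3) by (metis Diff_iff finite_Diff)
    have AQ: "A i \<in> Q" if "i \<le> n" for i using A(1) that by blast
    have "(A(Suc n := m)) ` {..Suc n} = insert m (A ` {..n})" by (auto simp: atMost_Suc)
    then have "(A(Suc n := m)) ` {..Suc n} = Q" using A(1) m by auto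
    moreover have "le ((A(Suc n := m)) i) ((A(Suc n := m)) j)" if "i \<le> j" "j \<le> Suc n" for i j
      using that A(2) m AQ by (auto simp: le_Suc_eq)
    ultimately show ?thesis by blast
  qed
qed

section \<open>Tasks\<close>

definition branches :: "(nat \<Rightarrow> nat) \<Rightarrow> nat \<Rightarrow> nat set set" where
  "branches x j = {A. \<forall>m. near x j m A}"

text \<open>For a task \<open>x\<close> this is the compact family K that it contributes when its
  intervals are the blocks of \<open>g\<close>.\<close>

definition selections :: "(nat \<Rightarrow> nat) \<Rightarrow> (nat \<Rightarrow> nat) \<Rightarrow> nat set set" where
  "selections x g = {A. \<forall>m. follows x g m A}"

text \<open>The first clause says that every coded trace extends to a branch, which makes
  \<open>near\<close> persist downwards in \<open>m\<close>. That the sets increase and contain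
  \<open>UNIV\<close> from the start is what \<open>branch_selection\<close> needs.\<close>

definition task :: "(nat \<Rightarrow> nat) \<Rightarrow> bool" where
  "task x \<longleftrightarrow>
     (\<forall>j m A. near x j m A \<longrightarrow> (\<exists>X\<in>branches x j. X \<inter> {..<m} = A \<inter> {..<m})) \<and>
     (\<forall>j. branches x j \<subseteq> branches x (Suc j)) \<and> UNIV \<in> branches x 0"

lemma near_local: "A \<inter> {..<m} = B \<inter> {..<m} \<Longrightarrow> near x j m A \<Longrightarrow> near x j m B"
  by (auto simp: near_def)

lemma near_Suc: "task x \<Longrightarrow> near x j (Suc m) A \<Longrightarrow> near x j m A"
proof -
  assume x: "task x" and A: "near x j (Suc m) A"
  then obtain X where X: "X \<in> branches x j" "X \<inter> {..<Suc m} = A \<inter> {..<Suc m}"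
    unfolding task_def by blast
  have "X \<inter> {..<m} = A \<inter> {..<m}" using X(2) by (auto simp: lessThan_Suc)
  with X(1) show ?thesis unfolding branches_def by (blast intro: near_local)
qed

lemma follows_local:
  assumes "A \<inter> {..<m} = B \<inter> {..<m}" "follows x g m A"
  shows "follows x g m B"
  unfolding follows_def
proof (intro allI impI)
  fix n assume n: "bnd g (Suc n) \<le> m"
  then have "block g n \<subseteq> {..<m}" unfolding block_def by auto
  then have "A \<inter> block g n = B \<inter> block g n" using assms(1) by blast
  then show "\<exists>t\<in>coded x n (bnd g (Suc n)). t \<inter> block g n = B \<inter> block g n"
    using assms(2) n unfolding follows_def by metis
qed

lemma follows_Suc: "follows x g (Suc m) A \<Longrightarrow> follows x g m A"
  by (simp add: follows_def)

text \<open>Blocks before the j-th are filled by \<open>UNIV\<close>, and from the j-th on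
  \<open>X\<close> itself is available, because the compact sets increase. So every branch is a
  selection up to a finite set.\<close>

lemma branch_selection:
  assumes x: "task x" and X: "X \<in> branches x j"
  shows "X \<union> {..<bnd g j} \<in> selections x g"
proof -
  have mono: "branches x i \<subseteq> branches x i'" if "i \<le> i'" for i i'
    using lift_Suc_mono_le[of "branches x" i i'] x that by (auto simp: task_def)
  have sel: "\<exists>t\<in>coded x n (bnd g (Suc n)). t \<inter> block g n = (X \<union> {..<bnd g j}) \<inter> block g n" for n
  proof -
    have "\<exists>Y\<in>branches x n. Y \<inter> block g n = (X \<union> {..<bnd g j}) \<inter> block g n"
    proof (cases "j \<le> n")
      case True
      then have "bnd g j \<le> bnd g n" by (rule strict_mono_leD[OF bnd_strict_mono])
      then show ?thesis using mono[OF True] X by (intro bexI[of _ X]) (auto simp: block_def)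
    next
      case False
      then have "bnd g (Suc n) \<le> bnd g j" by (intro strict_mono_leD[OF bnd_strict_mono]) simp
      then show ?thesis using mono[of 0 n] x by (intro bexI[of _ UNIV]) (auto simp: block_def task_def)
    qed
    then obtain Y where Y: "Y \<in> branches x n" "Y \<inter> block g n = (X \<union> {..<bnd g j}) \<inter> block g n"
      by blast
    then obtain t where t: "t \<in> coded x n (bnd g (Suc n))"
        "t \<inter> {..<bnd g (Suc n)} = Y \<inter> {..<bnd g (Suc n)}"
      unfolding branches_def near_def by blast
    moreover have "block g n \<subseteq> {..<bnd g (Suc n)}" unfolding block_def by auto
    ultimately have "t \<inter> block g n = Y \<inter> block g n" by blast
    then show ?thesis using t(1) Y(2) by auto
  qed
  show ?thesis unfolding selections_def follows_def by (intro CollectI allI impI sel)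
qed

lemma task_exists:
  assumes C: "\<And>n. cantor_compact (C n)" and inc: "\<And>n. C n \<subseteq> C (Suc n)" and U: "UNIV \<in> C 0"
  obtains x where "task x" "\<And>n. branches x n = C n"
    "\<And>n m. coded x n m = (\<lambda>X. X \<inter> {..<m}) ` C n"
proof -
  \<comment> \<open>The finite set of traces on \<open>m\<close> is coded by two layers of
    \<open>set_encode\<close>, inverse to the two layers of \<open>set_decode\<close> in
    \<open>coded\<close>.\<close>
  define x where "x p = (case prod_decode p of (n, m) \<Rightarrow>
      set_encode (set_encode ` (\<lambda>X. X \<inter> {..<m}) ` C n))" for p
  have coded: "coded x n m = (\<lambda>X. X \<inter> {..<m}) ` C n" for n m
  proof -
    have "finite ((\<lambda>X. X \<inter> {..<m}) ` C n)"
      by (rule finite_subset[of _ "Pow {..<m}"]) auto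
    then have "set_decode (x (prod_encode (n, m))) = set_encode ` (\<lambda>X. X \<inter> {..<m}) ` C n"
      unfolding x_def by (simp add: set_encode_inverse)
    then have "coded x n m = (\<lambda>X. set_decode (set_encode (X \<inter> {..<m}))) ` C n"
      unfolding coded_def by (simp add: image_image)
    then show ?thesis by (simp add: set_encode_inverse)
  qed
  have near: "near x n m A \<longleftrightarrow> (\<exists>X\<in>C n. X \<inter> {..<m} = A \<inter> {..<m})" for n m A
    unfolding near_def coded by (auto simp: Int_assoc)
  have br: "branches x n = C n" for n
    unfolding branches_def near using cantor_compact_limit[OF C] by blast
  have "task x" unfolding task_def br near using inc U by blast
  with br coded show ?thesis using that by blast
qed

section \<open>The generators of the ultrafilter\<close>

text \<open>Abstracts what \<open>pathway_levels\<close> provides for \<open>linking\<close>, with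
  membership of ordinals replaced by a well-founded relation. The well order \<open>W\<close> ranks
  the reals of the same level.\<close>

locale levels =
  fixes lt :: "'o rel" and lev :: "(nat \<Rightarrow> nat) \<Rightarrow> 'o" and f :: "'o \<Rightarrow> nat \<Rightarrow> nat"
    and W :: "(nat \<Rightarrow> nat) rel"
  assumes wf_lt: "wf lt" and trans_lt: "trans lt"
    and total_lt: "\<And>x y. (lev x, lev y) \<in> lt \<or> lev x = lev y \<or> (lev y, lev x) \<in> lt"
    and W: "well_order_on UNIV W"
    and pathway: "\<And>n r x. \<lbrakk>\<And>i. i < n \<Longrightarrow> lev (x i) = lev (x (Suc i)) \<or> (lev (x i), lev (x (Suc i))) \<in> lt;
       \<And>i. i < r \<Longrightarrow> (lev (x i), lev (x n)) \<in> lt\<rbrakk>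
     \<Longrightarrow> (restrict x {..<n + 1})(n + 1 := f (lev (x n))) \<in> linking n (map (\<lambda>i. f (lev (x i))) [0..<r])"
begin

definition prec :: "(nat \<Rightarrow> nat) rel" where
  "prec = {(y, x). (lev y, lev x) \<in> lt \<or> lev y = lev x \<and> (y, x) \<in> W - Id}"

text \<open>\<open>Y\<close> stands for the active reals that precede \<open>x\<close>. Those at the
  level of \<open>x\<close> enter only through their branches: the passage from branches to
  selections at that level is made later, by the pathway.\<close>

definition stage :: "(nat \<Rightarrow> nat) \<Rightarrow> (nat \<Rightarrow> nat) set \<Rightarrow> nat set set" where
  "stage x Y = (\<Union>y\<in>{y \<in> Y. (lev y, lev x) \<in> lt}. selections y (f (lev y))) \<union>
     (\<Union>y\<in>insert x {y \<in> Y. lev y = lev x}. \<Union>j. branches y j)"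

definition active :: "(nat \<Rightarrow> nat) \<Rightarrow> bool" where
  "active = wfrec prec (\<lambda>a x. task x \<and> sfip (stage x {y. (y, x) \<in> prec \<and> a y}))"

lemma stage_selection:
  "y \<in> Y \<Longrightarrow> (lev y, lev x) \<in> lt \<Longrightarrow> A \<in> selections y (f (lev y)) \<Longrightarrow> A \<in> stage x Y"
  unfolding stage_def by (intro UnI1 UN_I[of y]) simp_all

lemma stage_branch:
  "y = x \<or> y \<in> Y \<and> lev y = lev x \<Longrightarrow> A \<in> branches y j \<Longrightarrow> A \<in> stage x Y"
  unfolding stage_def by (intro UnI2 UN_I[of y] UN_I[of j]) auto

lemma wf_prec: "wf prec"
proof -
  have "wf (W - Id)" using W by (simp add: well_order_on_def)
  then have "wf (inv_image (lt <*lex*> (W - Id)) (\<lambda>x. (lev x, x)))"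
    by (intro wf_inv_image wf_lex_prod wf_lt)
  also have "inv_image (lt <*lex*> (W - Id)) (\<lambda>x. (lev x, x)) = prec"
    unfolding prec_def inv_image_def lex_prod_def by auto
  finally show ?thesis .
qed

lemma active_iff: "active x \<longleftrightarrow> task x \<and> sfip (stage x {y. (y, x) \<in> prec \<and> active y})"
proof -
  have "{y. (y, x) \<in> prec \<and> cut active prec x y} = {y. (y, x) \<in> prec \<and> active y}"
    by (auto simp: cut_def)
  then show ?thesis
    unfolding active_def by (subst wfrec[OF wf_prec]) simp
qed

lemma active_task: "active x \<Longrightarrow> task x"
  by (rule conjunct1[OF iffD1[OF active_iff]])

definition below :: "'o \<Rightarrow> nat set set" where
  "below \<delta> = \<Union>{selections y (f (lev y)) | y. active y \<and> (lev y, \<delta>) \<in> lt}"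

definition at_level :: "'o \<Rightarrow> nat set set" where
  "at_level \<delta> = \<Union>{branches y j | y j. active y \<and> lev y = \<delta>}"

definition generators :: "nat set set" where
  "generators = \<Union>{selections y (f (lev y)) | y. active y}"

text \<open>If no bound existed for some \<open>j\<close> and \<open>k\<close>, Koenig's lemma would
  produce actual selections of the lower tasks and branches of the top ones without a common element
  from \<open>k\<close> on, contrary to the strong finite intersection property.\<close>

lemma compatible_active:
  assumes act: "\<And>i. i \<le> n \<Longrightarrow> active (x i)"
    and low: "\<And>i. i < r \<Longrightarrow> (lev (x i), \<delta>) \<in> lt"
    and top: "\<And>i. r \<le> i \<Longrightarrow> i \<le> n \<Longrightarrow> lev (x i) = \<delta>"
    and sfip: "sfip (below \<delta> \<union> at_level \<delta>)"
  shows "compatible n (map (\<lambda>i. f (lev (x i))) [0..<r]) x"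
proof (rule ccontr)
  let ?\<phi> = "map (\<lambda>i. f (lev (x i))) [0..<r]"
  assume "\<not> ?thesis"
  then obtain j k where bad: "\<And>m0. \<exists>m\<ge>m0. \<not> compatible_at n ?\<phi> j k m x"
    unfolding compatible_def by blast
  define \<Phi> where "\<Phi> m A \<longleftrightarrow> (\<forall>i\<le>n. if i < length ?\<phi> then follows (x i) (?\<phi> ! i) m (A i)
      else near (x i) j m (A i)) \<and> \<not> meet n k m A" for m and A :: "nat \<Rightarrow> nat set"
  have anti: "\<Phi> m A" if "\<Phi> (Suc m) A" for m A
    using that follows_Suc near_Suc[OF active_task[OF act]] unfolding \<Phi>_def meet_def
    by (auto split: if_splits)
  have "\<exists>A. \<Phi> m A" for m
  proof -
    \<comment> \<open>A failure beyond \<open>m\<close> restricts to one at \<open>m\<close>, since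
      the conditions are inherited downwards.\<close>
    obtain m' A where m': "m \<le> m'" "\<Phi> m' A"
      using bad[of m] unfolding compatible_at_def \<Phi>_def by blast
    then have "\<Phi> m A" by (induction rule: inc_induct) (auto intro: anti)
    then show ?thesis by blast
  qed
  moreover have "\<Phi> m B" if AB: "\<And>i. i \<le> n \<Longrightarrow> A i \<inter> {..<m} = B i \<inter> {..<m}" and A: "\<Phi> m A" for m A B
  proof -
    have "meet n k m A" if "meet n k m B"
      using that AB unfolding meet_def by (metis IntD1 IntI atLeastLessThan_iff lessThan_iff)
    then show ?thesis using A follows_local[OF AB] near_local[OF AB] unfolding \<Phi>_def by meson
  qed
  ultimately obtain A where A: "\<And>m. \<Phi> m A" using koenig[of n \<Phi>, OF _ anti] by metis
  have "A i \<in> below \<delta> \<union> at_level \<delta>" if i: "i \<le> n" for i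
  proof (cases "i < r")
    case True
    have "follows (x i) (f (lev (x i))) m (A i)" for m
    proof -
      have "if i < length ?\<phi> then follows (x i) (?\<phi> ! i) m (A i) else near (x i) j m (A i)"
        using A[of m] i unfolding \<Phi>_def by blast
      then show ?thesis using True by simp
    qed
    then have "A i \<in> selections (x i) (f (lev (x i)))" by (simp add: selections_def)
    then show ?thesis using act[OF i] low[OF True] unfolding below_def by blast
  next
    case False
    then have "A i \<in> branches (x i) j"
      using A i unfolding \<Phi>_def branches_def by auto
    moreover have "lev (x i) = \<delta>" using top[of i] False i by simp
    ultimately show ?thesis using act[OF i] unfolding at_level_def by blast
  qed
  then have "infinite (\<Inter>(A ` {..n}))" by (intro sfipD[OF sfip]) auto
  then obtain l where l: "k \<le> l" "l \<in> \<Inter>(A ` {..n})"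
    unfolding infinite_nat_iff_unbounded_le by blast
  then have "meet n k (Suc l) A" by (auto simp: meet_def)
  moreover have "\<not> meet n k (Suc l) A" using A[of "Suc l"] by (simp add: \<Phi>_def)
  ultimately show False by simp
qed

text \<open>The level of the last task is the top one. The tasks are compatible by
  \<open>compatible_active\<close>, and the pathway turns this into linkedness, which gives common
  elements of the selections beyond every \<open>k\<close>.\<close>

lemma selections_infinite:
  fixes n :: nat
  assumes act: "\<And>i. i \<le> n \<Longrightarrow> active (x i)"
    and A: "\<And>i. i \<le> n \<Longrightarrow> A i \<in> selections (x i) (f (lev (x i)))"
    and sorted: "\<And>i j. i \<le> j \<Longrightarrow> j \<le> n \<Longrightarrow> lev (x i) = lev (x j) \<or> (lev (x i), lev (x j)) \<in> lt"
    and sfip: "sfip (below (lev (x n)) \<union> at_level (lev (x n)))"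
  shows "infinite (\<Inter>(A ` {..n}))"
proof -
  \<comment> \<open>The tasks are sorted by level, so \<open>r\<close> is where the top level
    begins.\<close>
  define r where "r = (LEAST i. lev (x i) = lev (x n))"
  have r: "lev (x r) = lev (x n)" "r \<le> n"
    unfolding r_def
    using LeastI[of "\<lambda>i::nat. lev (x i) = lev (x n)" n]
      Least_le[of "\<lambda>i::nat. lev (x i) = lev (x n)" n] by simp_all
  have irr: "(\<delta>, \<delta>) \<notin> lt" for \<delta> using wf_lt by simp
  have low: "(lev (x i), lev (x n)) \<in> lt" if "i < r" for i
    using sorted[of i n] not_less_Least[of i "\<lambda>i. lev (x i) = lev (x n)", folded r_def] that r(2)
    by auto
  have top: "lev (x i) = lev (x n)" if "r \<le> i" "i \<le> n" for i
  proof (rule ccontr)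
    assume "lev (x i) \<noteq> lev (x n)"
    then have "(lev (x n), lev (x i)) \<in> lt" "(lev (x i), lev (x n)) \<in> lt"
      using sorted[OF that] sorted[OF that(2) order_refl] r(1) by auto
    then show False using irr transD[OF trans_lt] by blast
  qed
  define \<phi> where "\<phi> = map (\<lambda>i. f (lev (x i))) [0..<r]"
  \<comment> \<open>The point to which the pathway applies: the tasks, followed by the value of
    \<open>f\<close> at the top level.\<close>
  define y where "y = (restrict x {..<n + 1})(n + 1 := f (lev (x n)))"
  have y: "y i = x i" if "i \<le> n" for i using that by (simp add: y_def)
  have "compatible n \<phi> x" unfolding \<phi>_def by (rule compatible_active[OF act low top sfip])
  then have "compatible n \<phi> y" by (simp add: compatible_def compatible_at_def y cong: if_cong)
  moreover have "y \<in> linking n \<phi>" unfolding y_def \<phi>_def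
    by (rule pathway) (use sorted low in auto)
  ultimately have linked: "linked n \<phi> y" by (simp add: linking_def)
  have fol: "follows (y i) (if i < length \<phi> then \<phi> ! i else y (Suc n)) m (A i)" if "i \<le> n" for i m
    using A[OF that] top[of i] that y[OF that] by (auto simp: selections_def \<phi>_def y_def)
  show ?thesis
    unfolding infinite_nat_iff_unbounded_le
  proof
    fix k
    obtain m where "linked_at n \<phi> k m y" using linked unfolding linked_def by blast
    then have "meet n k m A" using fol unfolding linked_at_def by blast
    then show "\<exists>l\<ge>k. l \<in> \<Inter>(A ` {..n})" unfolding meet_def by auto
  qed
qed

text \<open>Choose a task for each set and sort by level. The predicate \<open>P\<close> serves two
  applications: to the levels below a given one inside the induction, and to all levels at the
  end.\<close>

lemma infinite_Inter_generators:
  assumes Q: "finite Q" "Q \<noteq> {}"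
    and gen: "\<And>A. A \<in> Q \<Longrightarrow> \<exists>y. active y \<and> P (lev y) \<and> A \<in> selections y (f (lev y))"
    and sfip: "\<And>\<delta>. P \<delta> \<Longrightarrow> sfip (below \<delta> \<union> at_level \<delta>)"
  shows "infinite (\<Inter>Q)"
proof -
  obtain y where y: "\<And>A. A \<in> Q \<Longrightarrow> active (y A) \<and> P (lev (y A)) \<and> A \<in> selections (y A) (f (lev (y A)))"
    using gen by metis
  obtain n :: nat and A where A: "A ` {..n} = Q"
      "\<And>i j. i \<le> j \<Longrightarrow> j \<le> n \<Longrightarrow> lev (y (A i)) = lev (y (A j)) \<or> (lev (y (A i)), lev (y (A j))) \<in> lt"
    using finite_sorted_enumeration[OF Q, of "\<lambda>A B. lev (y A) = lev (y B) \<or> (lev (y A), lev (y B)) \<in> lt"]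
      total_lt transD[OF trans_lt] by (smt (verit, best))
  have "A i \<in> Q" if "i \<le> n" for i using A(1) that by blast
  then have "infinite (\<Inter>(A ` {..n}))"
    by (intro selections_infinite[of n "\<lambda>i. y (A i)"] A(2) sfip) (use y in auto)
  then show ?thesis by (simp add: A(1))
qed

text \<open>By induction on the level. Sets from lower levels alone are handled by the induction
  hypothesis at the highest level that occurs. Otherwise all sets lie in the stage of the
  \<open>W\<close>-last of the tasks chosen at level \<delta>, and that task is active.\<close>

lemma sfip_level: "sfip (below \<delta> \<union> at_level \<delta>)"
  using wf_lt
proof (induction \<delta> rule: wf_induct_rule)
  case (less \<delta>)
  show ?case unfolding sfip_def
  proof (intro allI impI)
    fix Q assume Q: "Q \<subseteq> below \<delta> \<union> at_level \<delta>" "finite Q"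
    show "infinite (\<Inter>Q)"
    proof (cases "Q \<subseteq> below \<delta>")
      case True
      show ?thesis
      proof (cases "Q = {}")
        case False
        show ?thesis
          by (rule infinite_Inter_generators[OF Q(2) False, of "\<lambda>\<gamma>. (\<gamma>, \<delta>) \<in> lt"])
            (use True less in \<open>auto simp: below_def\<close>)
      qed simp
    next
      case False
      define Q' where "Q' = Q - below \<delta>"
      have "\<exists>y j. active y \<and> lev y = \<delta> \<and> A \<in> branches y j" if "A \<in> Q'" for A
        using that Q(1) unfolding Q'_def at_level_def by blast
      then obtain y j where y: "\<And>A. A \<in> Q' \<Longrightarrow> active (y A) \<and> lev (y A) = \<delta> \<and> A \<in> branches (y A) (j A)"
        by metis
      have lin: "trans W" "total_on UNIV W" "refl_on UNIV W"
        using W unfolding well_order_on_def linear_order_on_def partial_order_on_def preorder_on_def by auto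
      then have tot: "(p, q) \<in> W \<or> (q, p) \<in> W" for p q
        unfolding total_on_def refl_on_def by (cases "p = q") auto
      obtain x where x: "x \<in> y ` Q'" "\<And>z. z \<in> y ` Q' \<Longrightarrow> (z, x) \<in> W"
      proof -
        have "finite (y ` Q')" "y ` Q' \<noteq> {}" using Q(2) False unfolding Q'_def by auto
        then have "\<exists>x\<in>y ` Q'. \<forall>z\<in>y ` Q'. (z, x) \<in> W"
          by (rule finite_has_greatest) (use tot transD[OF lin(1)] in blast)+
        then show ?thesis using that by blast
      qed
      have x': "active x" "lev x = \<delta>" using x(1) y by auto
      have "A \<in> stage x {y. (y, x) \<in> prec \<and> active y}" if A: "A \<in> Q" for A
      proof (cases "A \<in> below \<delta>")
        case True
        then obtain z where "active z" "(lev z, \<delta>) \<in> lt" "A \<in> selections z (f (lev z))"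
          unfolding below_def by blast
        then show ?thesis using x'(2) by (intro stage_selection) (auto simp: prec_def)
      next
        case False
        then have A': "A \<in> Q'" using A by (simp add: Q'_def)
        then have "y A = x \<or> (y A, x) \<in> prec"
          using x(2)[of "y A"] y[OF A'] x'(2) unfolding prec_def by auto
        then show ?thesis using y[OF A'] x'(2) by (intro stage_branch[of "y A" _ _ _ "j A"]) auto
      qed
      then have "Q \<subseteq> stage x {y. (y, x) \<in> prec \<and> active y}" by blast
      moreover have "sfip (stage x {y. (y, x) \<in> prec \<and> active y})"
        using x'(1) active_iff[of x] by simp
      ultimately show ?thesis using sfipD Q(2) by simp
    qed
  qed
qed

lemma sfip_generators: "sfip generators"
  unfolding sfip_def
proof (intro allI impI)
  fix Q assume Q: "Q \<subseteq> generators" "finite Q"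
  show "infinite (\<Inter>Q)"
  proof (cases "Q = {}")
    case False
    show ?thesis
      by (rule infinite_Inter_generators[OF Q(2) False, of "\<lambda>_. True"])
        (use Q(1) sfip_level in \<open>auto simp: generators_def\<close>)
  qed simp
qed

lemma strong_P_point_extension:
  assumes U: "ultrafilter U" and gen: "generators \<subseteq> U"
  shows "strong_P_point U"
  unfolding strong_P_point_def
proof (intro conjI allI impI U)
  fix C :: "nat \<Rightarrow> nat set set"
  assume C: "\<forall>n. cantor_compact (C n) \<and> C n \<subseteq> U"
  have up: "A \<in> U \<Longrightarrow> A \<subseteq> B \<Longrightarrow> B \<in> U" and int: "A \<in> U \<Longrightarrow> B \<in> U \<Longrightarrow> A \<inter> B \<in> U" for A B
    using U unfolding ultrafilter_def by blast+
  \<comment> \<open>Finite unions with \<open>UNIV\<close> added satisfy the demands of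
    \<open>task\<close> while remaining compact and inside \<open>U\<close>.\<close>
  define C' where "C' n = insert UNIV (\<Union>i\<le>n. C i)" for n
  have "cantor_compact (C' n)" for n
  proof -
    have "(\<lambda>A n. n \<in> A) ` C' n = insert (\<lambda>n. True) (\<Union>i\<le>n. (\<lambda>A n. n \<in> A) ` C i)"
      unfolding C'_def by auto
    then show ?thesis using C unfolding cantor_compact_def
      by (simp add: compact_UN compact_insert)
  qed
  moreover have "C' n \<subseteq> C' (Suc n)" "UNIV \<in> C' 0" for n
    unfolding C'_def by auto
  ultimately obtain x where x: "task x" "\<And>n. branches x n = C' n"
    "\<And>n m. coded x n m = (\<lambda>X. X \<inter> {..<m}) ` C' n"
    using task_exists[of C'] by blast
  have UNIV_U: "UNIV \<in> U" using U by (simp add: ultrafilter_def)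
  have C'U: "C' n \<subseteq> U" for n using C UNIV_U by (auto simp: C'_def)
  have sel: "selections y (f (lev y)) \<subseteq> U" if "active y" for y
    using gen that unfolding generators_def by blast
  \<comment> \<open>A branch differs from a selection, which is a generator, by a finite initial
    segment only.\<close>
  have "branches y j \<subseteq> U" if "active y" for y j
  proof
    fix X assume "X \<in> branches y j"
    then have "X \<union> {..<bnd (f (lev y)) j} \<in> U"
      using branch_selection[OF active_task] sel that by blast
    moreover have "- {..<bnd (f (lev y)) j} \<in> U"
      using U ultrafilter_infinite[OF U] unfolding ultrafilter_def by blast
    ultimately have "(X \<union> {..<bnd (f (lev y)) j}) \<inter> - {..<bnd (f (lev y)) j} \<in> U"
      by (rule int)
    then show "X \<in> U" by (rule up) blast
  qed
  \<comment> \<open>Everything with which \<open>x\<close> has to be consistent already lies in the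
    ultrafilter, so its task is accepted.\<close>
  then have "stage x {y. (y, x) \<in> prec \<and> active y} \<subseteq> U"
    using sel C'U unfolding stage_def x(2)[symmetric] by blast
  then have "active x" using active_iff x(1) sfip_mono[OF ultrafilter_sfip[OF U]] by blast
  let ?g = "f (lev x)"
  \<comment> \<open>Passing from \<open>C\<close> to \<open>C'\<close> has only enlarged the family
    of selections.\<close>
  have "{A. \<forall>n. \<exists>X\<in>C n. A \<inter> block ?g n = X \<inter> block ?g n} \<subseteq> selections x ?g"
  proof
    fix A assume A: "A \<in> {A. \<forall>n. \<exists>X\<in>C n. A \<inter> block ?g n = X \<inter> block ?g n}"
    have "\<exists>t\<in>coded x n (bnd ?g (Suc n)). t \<inter> block ?g n = A \<inter> block ?g n" for n
    proof -
      obtain X where X: "X \<in> C n" "A \<inter> block ?g n = X \<inter> block ?g n" using A by blast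
      have "X \<inter> {..<bnd ?g (Suc n)} \<inter> block ?g n = X \<inter> block ?g n" by (auto simp: block_def)
      then show ?thesis using X unfolding x(3) by (auto simp: C'_def)
    qed
    then show "A \<in> selections x ?g" by (simp add: selections_def follows_def)
  qed
  then show "\<exists>P. interval_partition P \<and> {A. \<forall>n. \<exists>X\<in>C n. A \<inter> P n = X \<inter> P n} \<subseteq> U"
    using sel[OF \<open>active x\<close>] interval_partition_block by (meson order_trans)
qed

end

theorem theorem28:
  assumes "\<exists>(\<kappa> :: 'k rel) W f S. multiple_d_pathway \<kappa> W f S"
  shows "\<exists>U. strong_P_point U"
proof -
  obtain \<kappa> :: "'k rel" and W f S where pw: "multiple_d_pathway \<kappa> W f S" using assms by blast
  obtain V :: "(nat \<Rightarrow> nat) rel" where "Well_order V \<and> Field V = UNIV"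
    using well_ordering ..
  then have V: "well_order_on UNIV V" by metis
  show ?thesis
  proof (rule pathway_levels[of \<kappa> W f S linking, OF pw projective_linking adequate_linking])
    fix lev :: "(nat \<Rightarrow> nat) \<Rightarrow> 'k hset"
    assume ord: "\<And>y. is_ordinal (lev y)" and
      link: "\<And>n r x. \<lbrakk>\<And>i. i < n \<Longrightarrow> lev (x i) = lev (x (Suc i)) \<or> lev (x i) \<in> elts (lev (x (Suc i)));
         \<And>i. i < r \<Longrightarrow> lev (x i) \<in> elts (lev (x n))\<rbrakk>
       \<Longrightarrow> (restrict x {..<n + 1})(n + 1 := f (lev (x n))) \<in> linking n (map (\<lambda>i. f (lev (x i))) [0..<r])"
    \<comment> \<open>Requiring the larger set to be an ordinal makes membership transitive on the
      whole type.\<close>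
    define lt where "lt = {(\<alpha> :: 'k hset, \<beta>). \<alpha> \<in> elts \<beta> \<and> is_ordinal \<beta>}"
    have lt_lev: "(lev x, lev y) \<in> lt \<longleftrightarrow> lev x \<in> elts (lev y)" for x y
      using ord by (simp add: lt_def)
    interpret levels lt lev f V
    proof
      show "wf lt" by (rule wf_subset[OF wf_hset_mem]) (auto simp: lt_def)
      show "trans lt"
      proof (rule transI)
        fix \<alpha> \<beta> \<gamma> assume "(\<alpha>, \<beta>) \<in> lt" "(\<beta>, \<gamma>) \<in> lt"
        then show "(\<alpha>, \<gamma>) \<in> lt" using is_ordinal_trans[of \<gamma> \<alpha> \<beta>] by (simp add: lt_def)
      qed
      show "(lev x, lev y) \<in> lt \<or> lev x = lev y \<or> (lev y, lev x) \<in> lt" for x y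
        unfolding lt_lev using is_ordinal_linear[OF ord ord] by blast
    qed (unfold lt_lev, (fact V link)+)
    obtain U where "ultrafilter U" "generators \<subseteq> U"
      using ultrafilter_extends[OF sfip_generators] .
    then show ?thesis using strong_P_point_extension by blast
  qed
qed

end
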